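(* Consider a potentially infinite set of null hypotheses $H_1,H_2,\dots$ for the distribution $P$ of an observation $X$, with associated $p$-values $p_1,p_2,\dots$ (based on $X$). Consider an ordering $\pi(1),\pi(2),\dots$ (potentially depending on $X$) and a set of critical values $\alpha_1,\alpha_2,\dots$ (potentially depending on $X$). Let $\lambda\in[0,1)$ be a parameter and assume that there exists a filtration $$\mathcal F_k=\sigma\bigl((\pi(i))_{1\le i\le k},(\mathbf 1\{p_{\pi(i)}\le\alpha_i\})_{1\le i\le k},(\mathbf 1\{p_{\pi(i)}>\lambda\})_{1\le i\le k}\bigr),\quad k\ge1,$$ such that for all $k\ge2$, $$\mathbf P(p_{\pi(k)}\le t\mid\mathcal F_{k-1},H_{\pi(k)}=0)\le t\quad\text{for all }t\in[0,1].$$ Then, for any $\delta\in(0,1)$, with probability at least $1-\delta$, it holds $$\forall k\ge1,\quad\sum_{i=1}^k(1-H_{\pi(i)})\mathbf 1\{p_{\pi(i)}\le\alpha_i\}\le\overline V_k,$$ for $$\overline V_k=\sum_{i=1}^k(1-H_{\pi(i)})\mathbf 1\{p_{\pi(i)}>\lambda\}\frac{\alpha_i}{1-\lambda}+\Delta\Bigl(\sum_{i=1}^k(1-H_{\pi(i)})\nu_i\Bigr),$$ where $\Delta(u)=2\sqrt{\varepsilon_u}\sqrt{u\vee1}+\frac12\varepsilon_u$, $\varepsilon_u=\log((1+\kappa)/\delta)+2\log(1+\log_2(u\vee1))$, $u>0$, $\kappa=\pi_\circ^2/6$ (with $\pi_\circ=3.14159\ldots$), and $\nu_i=\alpha_i\bigl(1+\min(\alpha_i,\lambda)/(1-\lambda)\bigr)$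 for $i\ge1$.
   Context: The symbol $H_i$ also denotes the status of the $i$-th null hypothesis: $H_i=0$ if it is true and $H_i=1$ if it is false. $u\vee1=\max(u,1)$.
   Formalization: Two hypotheses are added, without which the claim fails: each critical value α_k with k ≥ 2 is F_{k-1}-measurable (fails e.g. for uniform p-values with α_i = p_i, λ = 0), and all critical values α_i are nonnegative. *)

theory Defs
  imports "HOL-Probability.Probability" "HOL-Library.Extended_Nat"
begin

(* Indices 1, 2, ..., m of the hypotheses, where m = \<infinity> is allowed. *)
definition hyp_index :: "enat \<Rightarrow> nat set" where
  "hyp_index m = {i. 1 \<le> i \<and> enat i \<le> m}"

(* A null hypothesis is a set of candidate distributions of the observation;
   it is true (status 0) for the distribution P iff P belongs to it. *)
definition null_status :: "'x measure \<Rightarrow> (nat \<Rightarrow> 'x measure set) \<Rightarrow> nat \<Rightarrow> real" where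
  "null_status P H i = (if P \<in> H i then 0 else 1)"

(* Since the ordering is integer valued, the events {ord i = j} generate the sigma-algebra
   of ord i; an indicator and its event generate the same sigma-algebra. *)
definition pval_filtration ::
    "'a measure \<Rightarrow> (nat \<Rightarrow> 'a \<Rightarrow> real) \<Rightarrow> (nat \<Rightarrow> 'a \<Rightarrow> nat) \<Rightarrow> (nat \<Rightarrow> 'a \<Rightarrow> real) \<Rightarrow> real
      \<Rightarrow> nat \<Rightarrow> 'a measure" where
  "pval_filtration M p ord \<alpha> lam k = sigma (space M)
     ({{\<omega> \<in> space M. ord i \<omega> = j} | i j. i \<in> {1..k}}
      \<union> {{\<omega> \<in> space M. p (ord i \<omega>) \<omega> \<le> \<alpha> i \<omega>} | i. i \<in> {1..k}}
      \<union> {{\<omega> \<in> space M. p (ord i \<omega>) \<omega> > lam} | i. i \<in> {1..k}})"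

(* Conditional probability of A given the sigma-algebra F and the event B, i.e.
   P(A, B | F) / P(B | F).  Where P(B | F) = 0 the numerator vanishes almost surely as well,
   and the value is 0. If B belongs to F, this is P(A | F) almost surely on B. *)
definition cond_prob_given ::
    "'a measure \<Rightarrow> 'a measure \<Rightarrow> 'a set \<Rightarrow> 'a set \<Rightarrow> 'a \<Rightarrow> real" where
  "cond_prob_given M F B A \<omega> =
     real_cond_exp M F (indicator (A \<inter> B)) \<omega> / real_cond_exp M F (indicator B) \<omega>"

definition kappa :: real where
  "kappa = pi\<^sup>2 / 6"

definition eps :: "real \<Rightarrow> real \<Rightarrow> real" where
  "eps \<delta> u = ln ((1 + kappa) / \<delta>) + 2 * ln (1 + log 2 (max u 1))"

definition Delta :: "real \<Rightarrow> real \<Rightarrow> real" where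
  "Delta \<delta> u = 2 * sqrt (eps \<delta> u) * sqrt (max u 1) + eps \<delta> u / 2"

definition nu :: "real \<Rightarrow> real \<Rightarrow> real" where
  "nu lam a = a * (1 + min a lam / (1 - lam))"

definition Vbar ::
    "(nat \<Rightarrow> real) \<Rightarrow> (nat \<Rightarrow> 'a \<Rightarrow> real) \<Rightarrow> (nat \<Rightarrow> 'a \<Rightarrow> nat) \<Rightarrow> (nat \<Rightarrow> 'a \<Rightarrow> real) \<Rightarrow> real
      \<Rightarrow> real \<Rightarrow> nat \<Rightarrow> 'a \<Rightarrow> real" where
  "Vbar h p ord \<alpha> lam \<delta> k \<omega> =
     (\<Sum>i=1..k. (1 - h (ord i \<omega>)) * of_bool (p (ord i \<omega>) \<omega> > lam) * (\<alpha> i \<omega> / (1 - lam)))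
     + Delta \<delta> (\<Sum>i=1..k. (1 - h (ord i \<omega>)) * nu lam (\<alpha> i \<omega>))"

end

theory Submission
  imports Defs
begin

text \<open>
  Write \<open>D\<^sub>i = 1{p \<le> \<alpha>\<^sub>i} - 1{p > \<lambda>} \<alpha>\<^sub>i / (1 - \<lambda>)\<close> with \<open>p\<close> the \<open>i\<close>-th inspected p-value. On true nulls
  \<open>exp (\<theta> D\<^sub>i)\<close> is a combination of \<open>1{p \<le> \<alpha>\<^sub>i}\<close> and \<open>1{p \<le> \<lambda>}\<close> with nonnegative coefficients known
  at time \<open>i - 1\<close>, so super-uniformity and \<open>exp y \<le> 1 + y + y\<^sup>2 / (2 - \<theta>)\<close> for \<open>y \<le> \<theta> < 2\<close> bound its
  conditional mean by \<open>exp (g \<nu>\<^sub>i)\<close> with \<open>g = \<theta>\<^sup>2 / (2 - \<theta>)\<close>. The products of \<open>exp (\<theta> D\<^sub>i - g \<nu>\<^sub>i)\<close> over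
  the true nulls among \<open>2, \<dots>, k\<close> thus form a nonnegative supermartingale, and Ville's inequality
  bounds the sum of the \<open>D\<^sub>i\<close> by the line \<open>x u / 2 + e / x + e / 2\<close> in the accumulated \<open>u\<close> of the
  \<open>\<nu>\<^sub>i\<close>, where \<open>\<theta> = 2 x / (2 + x)\<close>, outside an event of probability \<open>exp (- e)\<close>.

  One line is used for each dyadic block \<open>2\<^sup>j \<le> u < 2\<^sup>j\<^sup>+\<^sup>1\<close>; it stays below
  \<open>3/2 sqrt (e u) + e / 2\<close> there, while \<open>\<Delta>(u)\<close> has the constant \<open>2\<close>. The difference is at least 1,
  which absorbs the first step, about which nothing is assumed. For \<open>u < 2\<close> this needs the
  block \<open>j = 0\<close> to receive twice its share of \<open>\<delta>\<close>, which is what the summand 1 in \<open>1 + \<kappa>\<close> pays for.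
\<close>

section \<open>Exponential inequalities\<close>

lemma exp_le_pade:
  fixes y :: real
  assumes "0 \<le> y" "y < 2"
  shows "exp y \<le> (2 + y) / (2 - y)"
proof -
  let ?f = "\<lambda>y::real. (2 + y) * exp (- y) - (2 - y)"
  have "?f 0 \<le> ?f y"
  proof (rule DERIV_nonneg_imp_nondecreasing[OF assms(1)])
    fix z :: real assume "0 \<le> z" "z \<le> y"
    have "(1 + z) * exp (- z) \<le> 1"
      using mult_right_mono[OF exp_ge_add_one_self[of z], of "exp (- z)"]
      by (simp flip: exp_add)
    moreover have "(?f has_real_derivative (1 - (1 + z) * exp (- z))) (at z)"
      by (auto intro!: derivative_eq_intros simp: algebra_simps)
    ultimately show "\<exists>d. (?f has_real_derivative d) (at z) \<and> d \<ge> 0"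
      by (intro exI[of _ "1 - (1 + z) * exp (- z)"]) auto
  qed
  then have "2 - y \<le> (2 + y) * exp (- y)" by simp
  then have "(2 - y) * exp y \<le> (2 + y) * exp (- y) * exp y"
    by (rule mult_right_mono) simp
  then have "(2 - y) * exp y \<le> 2 + y"
    by (simp add: mult.assoc flip: exp_add)
  then show ?thesis using assms by (simp add: field_simps)
qed

text \<open>For \<open>y >= 0\<close> the rational bound of \<open>exp_le_pade\<close> equals
  \<open>1 + y + y^2 / (2 - y)\<close>, and the denominator only shrinks when \<open>y\<close> is
  replaced by \<open>\<theta>\<close>. For \<open>y < 0\<close> the denominator 2 already
  suffices.\<close>

lemma exp_le_quadratic:
  fixes y \<theta> :: real
  assumes "y \<le> \<theta>" "0 \<le> \<theta>" "\<theta> < 2"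
  shows "exp y \<le> 1 + y + y\<^sup>2 / (2 - \<theta>)"
proof (cases "0 \<le> y")
  case True
  then have "exp y \<le> (2 + y) / (2 - y)" using assms by (intro exp_le_pade) auto
  also have "\<dots> = 1 + y + y\<^sup>2 / (2 - y)"
    using assms by (simp add: field_simps power2_eq_square)
  also have "\<dots> \<le> 1 + y + y\<^sup>2 / (2 - \<theta>)"
    using assms True by (intro add_left_mono divide_left_mono) auto
  finally show ?thesis .
next
  case False
  define z where "z = - y"
  have z: "z \<ge> 0" using False by (simp add: z_def)
  \<comment> \<open>The product is a difference of squares,
    \<open>(1 + z^2/2)^2 - z^2 = 1 + z^4/4\<close>. Hence \<open>1 - z + z^2/2\<close> dominates the
    reciprocal of the Taylor lower bound of \<open>exp z\<close>.\<close>
  have "1 \<le> (1 + z + z\<^sup>2 / 2) * (1 - z + z\<^sup>2 / 2)"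
  proof -
    have "(1 + z + z\<^sup>2 / 2) * (1 - z + z\<^sup>2 / 2) = 1 + (z\<^sup>2)\<^sup>2 / 4"
      by (simp add: power2_eq_square algebra_simps)
    then show ?thesis by simp
  qed
  also have "\<dots> \<le> exp z * (1 - z + z\<^sup>2 / 2)"
  proof (rule mult_right_mono[OF exp_lower_Taylor_quadratic[OF z]])
    show "0 \<le> 1 - z + z\<^sup>2 / 2"
      using zero_le_power2[of "1 - z"] by (simp add: power2_eq_square algebra_simps)
  qed
  finally have "exp y \<le> 1 - z + z\<^sup>2 / 2"
    by (simp add: z_def exp_minus field_simps)
  also have "\<dots> = 1 + y + y\<^sup>2 / 2" by (simp add: z_def)
  also have "\<dots> \<le> 1 + y + y\<^sup>2 / (2 - \<theta>)"
    using assms by (intro add_left_mono divide_left_mono) auto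
  finally show ?thesis .
qed

section \<open>Exponential moment of one increment\<close>

lemma nu_nonneg: "0 \<le> a \<Longrightarrow> 0 \<le> lam \<Longrightarrow> lam < 1 \<Longrightarrow> 0 \<le> nu lam a"
  by (simp add: nu_def)

lemma nu_mono:
  assumes "0 \<le> a" "a \<le> b" "0 \<le> lam" "lam < 1"
  shows "nu lam a \<le> nu lam b"
  unfolding nu_def using assms by (intro mult_mono add_left_mono divide_right_mono) auto

text \<open>As a function of the p-value, the exponentiated increment is a nonincreasing step
  function. \<open>mgf_0\<close> is its rightmost value, and \<open>mgf_A\<close> and
  \<open>mgf_L\<close> are its drops at \<open>a\<close> and at \<open>lam\<close>, whose sizes
  depend on which threshold comes first. Super-uniformity bounds probabilities of lower sets from
  above only, so the drops have to be nonnegative.\<close>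

definition mgf_0 :: "real \<Rightarrow> real \<Rightarrow> real \<Rightarrow> real" where
  "mgf_0 \<theta> lam a = exp (- \<theta> * (a / (1 - lam)))"

definition mgf_A :: "real \<Rightarrow> real \<Rightarrow> real \<Rightarrow> real" where
  "mgf_A \<theta> lam a = (if a \<le> lam then exp \<theta> - 1
     else exp (\<theta> * (1 - a / (1 - lam))) - exp (- \<theta> * (a / (1 - lam))))"

definition mgf_L :: "real \<Rightarrow> real \<Rightarrow> real \<Rightarrow> real" where
  "mgf_L \<theta> lam a = (if a \<le> lam then 1 - exp (- \<theta> * (a / (1 - lam)))
     else exp \<theta> - exp (\<theta> * (1 - a / (1 - lam))))"

lemma exp_increment_eq:
  assumes "0 \<le> lam" "lam < 1"
  shows "exp (\<theta> * (of_bool (q \<le> a) - of_bool (q > lam) * (a / (1 - lam))))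
    = mgf_0 \<theta> lam a + mgf_A \<theta> lam a * of_bool (q \<le> a) + mgf_L \<theta> lam a * of_bool (q \<le> lam)"
  by (auto simp: mgf_0_def mgf_A_def mgf_L_def)

lemma mgf_nonneg:
  assumes "0 \<le> \<theta>" "0 \<le> a" "lam < 1"
  shows "0 \<le> mgf_0 \<theta> lam a" "0 \<le> mgf_A \<theta> lam a" "0 \<le> mgf_L \<theta> lam a"
  using assms by (auto simp: mgf_0_def mgf_A_def mgf_L_def mult_left_le right_diff_distrib)

text \<open>The bound is free of \<open>a\<close>, so multiplying a test function by this
  coefficient keeps its integral finite.\<close>

lemma mgf_A_le:
  assumes "0 \<le> \<theta>" "0 \<le> a" "lam < 1"
  shows "mgf_A \<theta> lam a \<le> exp \<theta>"
proof -
  have "exp (\<theta> * (1 - a / (1 - lam))) \<le> exp \<theta>"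
    using assms by (simp add: mult_left_le)
  moreover have "0 \<le> exp (- \<theta> * (a / (1 - lam)))" by simp
  ultimately show ?thesis unfolding mgf_A_def by (smt (verit))
qed

text \<open>The left side is the mean of the exponentiated increment for a p-value uniform on [0,1].
  The increment then has mean 0, so the linear terms of \<open>exp_le_quadratic\<close> cancel. Its
  second moment is \<open>nu lam a\<close> if \<open>a \<le> lam\<close> and at most that
  otherwise.\<close>

lemma mgf_sum_le:
  assumes \<theta>: "0 \<le> \<theta>" "\<theta> < 2" and a: "0 \<le> a" "a \<le> 1" and lam: "0 \<le> lam" "lam < 1"
  shows "mgf_0 \<theta> lam a + mgf_A \<theta> lam a * a + mgf_L \<theta> lam a * lam
    \<le> exp (\<theta>\<^sup>2 / (2 - \<theta>) * nu lam a)"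
proof -
  define c where "c = a / (1 - lam)"
  define g where "g = \<theta>\<^sup>2 / (2 - \<theta>)"
  have c: "0 \<le> c" "a = c * (1 - lam)" using a lam by (auto simp: c_def)
  have g: "0 \<le> g" using \<theta> by (simp add: g_def)
  have E: "exp (\<theta> * d) \<le> 1 + \<theta> * d + g * d\<^sup>2" if "d \<le> 1" for d
    using exp_le_quadratic[of "\<theta> * d" \<theta>] that \<theta>
    by (simp add: g_def power_mult_distrib mult_left_le)
  have E1: "exp (- \<theta> * c) \<le> 1 - \<theta> * c + g * c\<^sup>2" using E[of "- c"] c by simp
  have E2: "exp \<theta> \<le> 1 + \<theta> + g" using E[of 1] by simp
  have E3: "exp (\<theta> * (1 - c)) \<le> 1 + \<theta> * (1 - c) + g * (1 - c)\<^sup>2" using E[of "1 - c"] c by simp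
  have "mgf_0 \<theta> lam a + mgf_A \<theta> lam a * a + mgf_L \<theta> lam a * lam \<le> 1 + g * nu lam a"
  proof (cases "a \<le> lam")
    case True
    have "mgf_0 \<theta> lam a + mgf_A \<theta> lam a * a + mgf_L \<theta> lam a * lam
        = exp (- \<theta> * c) * (1 - lam) + (exp \<theta> - 1) * a + lam"
      using True by (simp add: mgf_0_def mgf_A_def mgf_L_def c_def[symmetric] algebra_simps)
    also have "\<dots> \<le> (1 - \<theta> * c + g * c\<^sup>2) * (1 - lam) + (\<theta> + g) * a + lam"
      using E1 E2 lam a by (intro add_mono mult_right_mono) auto
    also have "\<dots> = 1 + g * (a + c * a)"
      unfolding c(2) by (simp add: algebra_simps power2_eq_square)
    also have "a + c * a = nu lam a"
      using True by (simp add: nu_def c_def algebra_simps)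
    finally show ?thesis .
  next
    case False
    have "mgf_0 \<theta> lam a + mgf_A \<theta> lam a * a + mgf_L \<theta> lam a * lam
        = exp (- \<theta> * c) * (1 - a) + exp (\<theta> * (1 - c)) * (a - lam) + exp \<theta> * lam"
      using False by (simp add: mgf_0_def mgf_A_def mgf_L_def c_def[symmetric] algebra_simps)
    also have "\<dots> \<le> (1 - \<theta> * c + g * c\<^sup>2) * (1 - a)
        + (1 + \<theta> * (1 - c) + g * (1 - c)\<^sup>2) * (a - lam) + (1 + \<theta> + g) * lam"
      using E1 E2 E3 lam a False by (intro add_mono mult_right_mono) auto
    \<comment> \<open>The exact second moment for \<open>lam < a\<close>; bounding
      \<open>1 - a + lam\<close> by 1 leaves \<open>c\<close>, which is \<open>nu lam a\<close> in
      this case.\<close>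
    also have "\<dots> = 1 + g * (c * (1 - a + lam))"
      unfolding c(2) by (simp add: algebra_simps power2_eq_square)
    also have "\<dots> \<le> 1 + g * (c * 1)"
      using False c g by (intro add_left_mono mult_left_mono) auto
    also have "c * 1 = nu lam a"
      using False lam by (simp add: nu_def c_def field_simps)
    finally show ?thesis .
  qed
  also have "\<dots> \<le> exp (g * nu lam a)" by simp
  finally show ?thesis by (simp add: g_def)
qed

section \<open>Super-uniformity tested against nonnegative functions\<close>

text \<open>Clearing the denominator of \<open>cond_prob_given\<close> gives
  \<open>P(A, B | F) \<le> t P(B | F)\<close> almost surely; integrating against the
  \<open>F\<close>-measurable \<open>G\<close> then removes the conditioning, although
  \<open>B\<close> itself may lie outside \<open>F\<close>.\<close>

lemma nn_integral_cond_prob_le: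
  fixes G :: "'a \<Rightarrow> ennreal"
  assumes "prob_space M" and F: "subalgebra M F"
    and [measurable]: "A \<in> sets M" "B \<in> sets M"
    and t: "0 \<le> t" and le: "AE \<omega> in M. cond_prob_given M F B A \<omega> \<le> t"
    and G[measurable]: "G \<in> borel_measurable F"
  shows "(\<integral>\<^sup>+\<omega>. G \<omega> * indicator (A \<inter> B) \<omega> \<partial>M) \<le> (\<integral>\<^sup>+\<omega>. G \<omega> * (ennreal t * indicator B \<omega>) \<partial>M)"
proof -
  interpret prob_space M by fact
  interpret finite_measure_subalgebra M F
    using F by unfold_locales
  interpret sigma_finite_subalgebra M F
    by (rule finite_measure_subalgebra_is_sigma_finite) unfold_locales
  have [measurable]: "G \<in> borel_measurable M"
    by (rule measurable_from_subalg[OF F G])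
  let ?n = "\<lambda>S. nn_cond_exp M F (indicator S)"
  have rce: "AE \<omega> in M. real_cond_exp M F (indicator S) \<omega> = enn2real (?n S \<omega>)"
    if [measurable]: "S \<in> sets M" for S
  proof -
    have "AE \<omega> in M. nn_cond_exp M F (\<lambda>_. 0) \<omega> = 0"
      using nn_cond_exp_F_meas[of "\<lambda>_. 0"] by (auto elim: AE_mp)
    moreover have "(\<lambda>x. ennreal (indicator S x)) = indicator S" "(\<lambda>x. ennreal (- indicator S x)) = (\<lambda>_. 0)"
      by (auto simp: fun_eq_iff indicator_def ennreal_neg)
    ultimately show ?thesis by (auto simp: real_cond_exp_def elim!: eventually_mono)
  qed
  \<comment> \<open>Both conditional expectations are at most 1 almost surely, so passing to reals
    by \<open>enn2real\<close> loses nothing.\<close>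
  have AB: "AE \<omega> in M. ?n (A \<inter> B) \<omega> \<le> ?n B \<omega>"
    by (rule nn_cond_exp_mono) (auto simp: indicator_def)
  have "AE \<omega> in M. ?n B \<omega> \<le> nn_cond_exp M F (\<lambda>_. 1) \<omega>"
    by (rule nn_cond_exp_mono) (auto simp: indicator_def)
  moreover have "AE \<omega> in M. nn_cond_exp M F (\<lambda>_. 1) \<omega> = 1"
    using nn_cond_exp_F_meas[of "\<lambda>_. 1"] by (auto elim: AE_mp)
  ultimately have B1: "AE \<omega> in M. ?n B \<omega> \<le> 1" by eventually_elim auto
  have "AE \<omega> in M. ?n (A \<inter> B) \<omega> \<le> ennreal t * ?n B \<omega>"
    using AB B1 le rce[of "A \<inter> B", simplified] rce[of B, simplified]
  proof eventually_elim
    case (elim \<omega>)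
    have fin: "?n B \<omega> < \<top>" "?n (A \<inter> B) \<omega> < \<top>"
      using le_less_trans[OF elim(2)] le_less_trans[OF order_trans[OF elim(1,2)]] by auto
    define a b where "a = enn2real (?n (A \<inter> B) \<omega>)" and "b = enn2real (?n B \<omega>)"
    have ab: "?n (A \<inter> B) \<omega> = ennreal a" "?n B \<omega> = ennreal b" "0 \<le> a" "0 \<le> b"
      using fin by (auto simp: a_def b_def)
    have "a \<le> b" using elim(1) ab by (simp add: ennreal_le_iff)
    moreover have "a / b \<le> t"
      using elim by (simp add: cond_prob_given_def a_def b_def)
    \<comment> \<open>Where \<open>b = 0\<close> the quotient is 0 by convention and says nothing;
      there \<open>a \<le> b\<close> forces \<open>a = 0\<close>.\<close>
    ultimately have "a \<le> t * b"
      using ab by (cases "b = 0") (auto simp: field_simps)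
    then show ?case
      using ab t by (simp add: ennreal_mult[symmetric] ennreal_leI)
  qed
  then have "(\<integral>\<^sup>+\<omega>. G \<omega> * ?n (A \<inter> B) \<omega> \<partial>M) \<le> (\<integral>\<^sup>+\<omega>. ennreal t * (G \<omega> * ?n B \<omega>) \<partial>M)"
    by (intro nn_integral_mono_AE, elim eventually_mono) (subst mult.left_commute, rule mult_left_mono, auto)
  then show ?thesis
    by (simp add: nn_cond_exp_intg nn_integral_cmult mult.left_commute[of _ "ennreal t"])
qed

text \<open>The level is rounded up to the grid of mesh \<open>1/n\<close>, which costs at most \<open>1/n\<close> times the
  (finite) integral of the test function.\<close>
lemma nn_integral_cond_prob_le_random:
  fixes G :: "'a \<Rightarrow> ennreal" and a q :: "'a \<Rightarrow> real"
  assumes M: "prob_space M" and F: "subalgebra M F"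
    and q[measurable]: "q \<in> borel_measurable M" and B[measurable]: "B \<in> sets M"
    and le: "\<And>t. t \<in> {0..1} \<Longrightarrow> AE \<omega> in M. cond_prob_given M F B {\<omega> \<in> space M. q \<omega> \<le> t} \<omega> \<le> t"
    and a[measurable]: "a \<in> borel_measurable F" and a01: "\<And>\<omega>. \<omega> \<in> space M \<Longrightarrow> 0 \<le> a \<omega> \<and> a \<omega> \<le> 1"
    and G[measurable]: "G \<in> borel_measurable F" and fin: "(\<integral>\<^sup>+\<omega>. G \<omega> \<partial>M) < \<infinity>"
  shows "(\<integral>\<^sup>+\<omega>. G \<omega> * (of_bool (q \<omega> \<le> a \<omega>) * indicator B \<omega>) \<partial>M)
    \<le> (\<integral>\<^sup>+\<omega>. G \<omega> * (ennreal (a \<omega>) * indicator B \<omega>) \<partial>M)"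
proof -
  interpret prob_space M by fact
  have GM[measurable]: "G \<in> borel_measurable M" and aM[measurable]: "a \<in> borel_measurable M"
    by (auto intro: measurable_from_subalg[OF F])
  let ?C = "\<integral>\<^sup>+\<omega>. G \<omega> \<partial>M"
  let ?R = "\<integral>\<^sup>+\<omega>. G \<omega> * (ennreal (a \<omega>) * indicator B \<omega>) \<partial>M"
  have step: "(\<integral>\<^sup>+\<omega>. G \<omega> * (of_bool (q \<omega> \<le> a \<omega>) * indicator B \<omega>) \<partial>M) \<le> ?R + ennreal (1 / real n) * ?C"
    if n: "n > 0" for n :: nat
  proof -
    \<comment> \<open>On the event \<open>J = j\<close> the rounded level is the constant
      \<open>j / n\<close>, and the indicator of that event can be moved into the test function
      because \<open>J\<close> is \<open>F\<close>-measurable. This reduces the random level to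
      finitely many fixed ones.\<close>
    define J where "J = (\<lambda>\<omega>. nat \<lceil>real n * a \<omega>\<rceil>)"
    have J[measurable]: "J \<in> measurable F (count_space UNIV)" unfolding J_def by measurable
    have JM[measurable]: "J \<in> measurable M (count_space UNIV)"
      by (rule measurable_from_subalg[OF F J])
    have Jb: "J \<omega> \<le> n" "a \<omega> \<le> real (J \<omega>) / real n" "real (J \<omega>) / real n \<le> a \<omega> + 1 / real n"
      if "\<omega> \<in> space M" for \<omega>
    proof -
      have "real n * a \<omega> \<le> real n" using a01[OF that] by (simp add: mult_left_le)
      then show "J \<omega> \<le> n" unfolding J_def by (simp add: nat_le_iff ceiling_le_iff)
      have J: "real (J \<omega>) = of_int \<lceil>real n * a \<omega>\<rceil>" using a01[OF that] unfolding J_def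
        by (simp add: less_le_trans[of "-1" 0])
      show "a \<omega> \<le> real (J \<omega>) / real n" using n unfolding J by (simp add: field_simps)
      have "real (J \<omega>) \<le> real n * a \<omega> + 1" unfolding J by linarith
      then show "real (J \<omega>) / real n \<le> a \<omega> + 1 / real n" using n by (simp add: field_simps)
    qed
    have "(\<integral>\<^sup>+\<omega>. G \<omega> * (of_bool (q \<omega> \<le> a \<omega>) * indicator B \<omega>) \<partial>M)
      \<le> (\<integral>\<^sup>+\<omega>. (\<Sum>j\<le>n. (G \<omega> * of_bool (J \<omega> = j)) * indicator ({\<omega> \<in> space M. q \<omega> \<le> real j / real n} \<inter> B) \<omega>) \<partial>M)"
    proof (rule nn_integral_mono)
      fix \<omega> assume w: "\<omega> \<in> space M"
      have "G \<omega> * (of_bool (q \<omega> \<le> a \<omega>) * indicator B \<omega>)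
        \<le> (G \<omega> * of_bool (J \<omega> = J \<omega>)) * indicator ({\<omega> \<in> space M. q \<omega> \<le> real (J \<omega>) / real n} \<inter> B) \<omega>"
        using Jb(2)[OF w] w by (auto simp: indicator_def)
      also have "\<dots> \<le> (\<Sum>j\<le>n. (G \<omega> * of_bool (J \<omega> = j)) * indicator ({\<omega> \<in> space M. q \<omega> \<le> real j / real n} \<inter> B) \<omega>)"
        using Jb(1)[OF w] w by (intro order_trans[OF _ member_le_sum[of "J \<omega>"]]) (auto simp: indicator_def)
      finally show "G \<omega> * (of_bool (q \<omega> \<le> a \<omega>) * indicator B \<omega>) \<le> \<dots>" .
    qed
    also have "\<dots> = (\<Sum>j\<le>n. \<integral>\<^sup>+\<omega>. (G \<omega> * of_bool (J \<omega> = j)) * indicator ({\<omega> \<in> space M. q \<omega> \<le> real j / real n} \<inter> B) \<omega> \<partial>M)"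
      by (intro nn_integral_sum) measurable
    also have "\<dots> \<le> (\<Sum>j\<le>n. \<integral>\<^sup>+\<omega>. (G \<omega> * of_bool (J \<omega> = j)) * (ennreal (real j / real n) * indicator B \<omega>) \<partial>M)"
      using n by (intro sum_mono nn_integral_cond_prob_le[OF M F] le) (auto simp: divide_simps)
    also have "\<dots> = (\<integral>\<^sup>+\<omega>. (\<Sum>j\<le>n. (G \<omega> * of_bool (J \<omega> = j)) * (ennreal (real j / real n) * indicator B \<omega>)) \<partial>M)"
      by (intro nn_integral_sum[symmetric]) measurable
    also have "\<dots> \<le> (\<integral>\<^sup>+\<omega>. G \<omega> * (ennreal (a \<omega>) * indicator B \<omega>) + ennreal (1 / real n) * G \<omega> \<partial>M)"
    proof (rule nn_integral_mono)
      fix \<omega> assume w: "\<omega> \<in> space M"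
      have "(\<Sum>j\<le>n. (G \<omega> * of_bool (J \<omega> = j)) * (ennreal (real j / real n) * indicator B \<omega>))
        = (\<Sum>j\<in>{J \<omega>}. (G \<omega> * of_bool (J \<omega> = j)) * (ennreal (real j / real n) * indicator B \<omega>))"
        using Jb(1)[OF w] by (intro sum.mono_neutral_right) auto
      also have "\<dots> = G \<omega> * (ennreal (real (J \<omega>) / real n) * indicator B \<omega>)" by simp
      also have "\<dots> \<le> G \<omega> * ((ennreal (a \<omega>) + ennreal (1 / real n)) * indicator B \<omega>)"
        using Jb(3)[OF w] a01[OF w]
        by (intro mult_left_mono mult_right_mono) (auto simp flip: ennreal_plus intro!: ennreal_leI)
      also have "\<dots> \<le> G \<omega> * (ennreal (a \<omega>) * indicator B \<omega>) + ennreal (1 / real n) * G \<omega>"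
        by (auto simp: indicator_def algebra_simps)
      finally show "(\<Sum>j\<le>n. (G \<omega> * of_bool (J \<omega> = j)) * (ennreal (real j / real n) * indicator B \<omega>)) \<le> \<dots>" .
    qed
    also have "\<dots> = ?R + ennreal (1 / real n) * ?C"
      by (simp add: nn_integral_add nn_integral_cmult)
    finally show ?thesis .
  qed
  \<comment> \<open>Here the finiteness of \<open>?C\<close> enters: with \<open>?C\<close> infinite
    the error term would not tend to 0.\<close>
  have "(\<lambda>n. ?R + ennreal (1 / real n) * ?C) \<longlonglongrightarrow> ?R + ennreal 0 * ?C"
    using fin by (intro tendsto_intros ennreal_tendsto_cmult tendsto_ennrealI lim_1_over_n) auto
  then show ?thesis
    by (intro LIMSEQ_le_const[of _ ?R]) (auto intro!: exI[of _ 1] step)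
qed

section \<open>Ville's inequality and the one-step bound\<close>

text \<open>The last hypothesis says in tested form that \<open>Z i\<close> has conditional mean at
  most 1 given \<open>F i\<close>. Freezing the product at its first passage of \<open>c\<close>
  turns the event about all \<open>k\<close> into one about the final value, to which Markov's
  inequality applies.\<close>

lemma ville_inequality:
  fixes Z :: "nat \<Rightarrow> 'a \<Rightarrow> ennreal" and F :: "nat \<Rightarrow> 'a measure" and c :: real
  assumes M: "prob_space M" and c: "0 < c"
    and F: "\<And>i. i \<le> n \<Longrightarrow> subalgebra M (F i)"
    and mono: "\<And>i. i < n \<Longrightarrow> sets (F i) \<subseteq> sets (F (Suc i))"
    and Z: "\<And>i. i < n \<Longrightarrow> Z i \<in> borel_measurable (F (Suc i))"
    and le: "\<And>i G. i < n \<Longrightarrow> G \<in> borel_measurable (F i) \<Longrightarrow> (\<integral>\<^sup>+\<omega>. G \<omega> \<partial>M) < \<infinity> \<Longrightarrow>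
      (\<integral>\<^sup>+\<omega>. G \<omega> * Z i \<omega> \<partial>M) \<le> (\<integral>\<^sup>+\<omega>. G \<omega> \<partial>M)"
  shows "emeasure M {\<omega> \<in> space M. \<exists>k\<le>n. ennreal c \<le> (\<Prod>i<k. Z i \<omega>)} \<le> ennreal (1 / c)"
proof -
  interpret prob_space M by fact
  \<comment> \<open>The product, frozen once it has reached the level \<open>c\<close>.\<close>
  define W where "W k \<omega> = rec_nat (1::ennreal) (\<lambda>i w. if ennreal c \<le> w then w else w * Z i \<omega>) k" for k \<omega>
  have W0: "W 0 = (\<lambda>_. 1)" by (simp add: W_def fun_eq_iff)
  have WS: "W (Suc k) = (\<lambda>\<omega>. if ennreal c \<le> W k \<omega> then W k \<omega> else W k \<omega> * Z k \<omega>)" for k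
    by (simp add: W_def fun_eq_iff)
  have W: "W k \<in> borel_measurable (F k) \<and> (\<integral>\<^sup>+\<omega>. W k \<omega> \<partial>M) \<le> 1" if "k \<le> n" for k
    using that
  proof (induction k)
    case 0
    then show ?case by (simp add: W0 emeasure_space_1)
  next
    case (Suc k)
    have k: "k < n" using Suc by simp
    have spc: "space (F (Suc k)) = space M" "space (F k) = space M"
      using F[of "Suc k"] F[of k] Suc.prems by (auto simp: subalgebra_def)
    have Wk[measurable]: "W k \<in> borel_measurable (F k)" and int: "(\<integral>\<^sup>+\<omega>. W k \<omega> \<partial>M) \<le> 1"
      using Suc by auto
    have [measurable]: "W k \<in> borel_measurable (F (Suc k))"
      using measurable_from_subalg[of "F (Suc k)" "F k", OF _ Wk] mono[OF k] spc
      by (auto simp: subalgebra_def)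
    have [measurable]: "Z k \<in> borel_measurable (F (Suc k))" by (rule Z[OF k])
    have [measurable]: "W k \<in> borel_measurable M" "Z k \<in> borel_measurable M"
      using Wk Z[OF k] F[of k] F[of "Suc k"] Suc.prems by (auto intro: measurable_from_subalg)
    \<comment> \<open>The part of \<open>W k\<close> that is not yet frozen. It is known at time
      \<open>k\<close> and has finite integral, so it is an admissible test function.\<close>
    let ?G = "\<lambda>\<omega>. W k \<omega> * of_bool (W k \<omega> < ennreal c)"
    have "(\<integral>\<^sup>+\<omega>. W (Suc k) \<omega> \<partial>M)
      = (\<integral>\<^sup>+\<omega>. W k \<omega> * of_bool (ennreal c \<le> W k \<omega>) + ?G \<omega> * Z k \<omega> \<partial>M)"
      by (intro nn_integral_cong) (auto simp: WS not_le)
    also have "\<dots> = (\<integral>\<^sup>+\<omega>. W k \<omega> * of_bool (ennreal c \<le> W k \<omega>) \<partial>M) + (\<integral>\<^sup>+\<omega>. ?G \<omega> * Z k \<omega> \<partial>M)"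
      by (intro nn_integral_add) measurable
    also have "\<dots> \<le> (\<integral>\<^sup>+\<omega>. W k \<omega> * of_bool (ennreal c \<le> W k \<omega>) \<partial>M) + (\<integral>\<^sup>+\<omega>. ?G \<omega> \<partial>M)"
    proof (intro add_left_mono le[OF k])
      have "(\<integral>\<^sup>+\<omega>. ?G \<omega> \<partial>M) \<le> (\<integral>\<^sup>+\<omega>. W k \<omega> \<partial>M)"
        by (intro nn_integral_mono) auto
      also have "\<dots> < \<infinity>" using int by (auto intro: le_less_trans)
      finally show "(\<integral>\<^sup>+\<omega>. ?G \<omega> \<partial>M) < \<infinity>" .
    qed measurable
    also have "\<dots> = (\<integral>\<^sup>+\<omega>. W k \<omega> * of_bool (ennreal c \<le> W k \<omega>) + ?G \<omega> \<partial>M)"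
      by (intro nn_integral_add[symmetric]) measurable
    also have "\<dots> = (\<integral>\<^sup>+\<omega>. W k \<omega> \<partial>M)"
      by (intro nn_integral_cong) (auto simp: not_le)
    finally have "(\<integral>\<^sup>+\<omega>. W (Suc k) \<omega> \<partial>M) \<le> 1" using int by (rule order_trans)
    moreover have "W (Suc k) \<in> borel_measurable (F (Suc k))" unfolding WS by measurable
    ultimately show ?case by blast
  qed
  \<comment> \<open>Either the process is at or above \<open>c\<close>, or it is still the plain
    product and no product so far has reached \<open>c\<close>.\<close>
  have dich: "ennreal c \<le> W k \<omega> \<or> (W k \<omega> = (\<Prod>i<k. Z i \<omega>) \<and> (\<forall>l\<le>k. (\<Prod>i<l. Z i \<omega>) < ennreal c))" for k \<omega>
  proof (induction k)
    case (Suc k)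
    then show ?case by (auto simp: WS le_Suc_eq mult.commute not_le)
  qed (auto simp: W0 not_le)
  have [measurable]: "W n \<in> borel_measurable M"
    using W[of n] F[of n] by (auto intro: measurable_from_subalg)
  have "emeasure M {\<omega> \<in> space M. \<exists>k\<le>n. ennreal c \<le> (\<Prod>i<k. Z i \<omega>)}
      \<le> emeasure M {\<omega> \<in> space M. 1 \<le> ennreal (1 / c) * W n \<omega>}"
  proof (rule emeasure_mono)
    show "{\<omega> \<in> space M. \<exists>k\<le>n. ennreal c \<le> (\<Prod>i<k. Z i \<omega>)} \<subseteq> {\<omega> \<in> space M. 1 \<le> ennreal (1 / c) * W n \<omega>}"
    proof safe
      fix \<omega> k assume "k \<le> n" "ennreal c \<le> (\<Prod>i<k. Z i \<omega>)"
      then have "ennreal c \<le> W n \<omega>" using dich[of n \<omega>] by (auto simp: not_less[symmetric])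
      then have "ennreal (1 / c) * ennreal c \<le> ennreal (1 / c) * W n \<omega>" by (rule mult_left_mono) simp
      then show "1 \<le> ennreal (1 / c) * W n \<omega>"
        using c by (simp flip: ennreal_mult)
    qed
  qed measurable
  also have "\<dots> \<le> ennreal (1 / c) * (\<integral>\<^sup>+\<omega>. W n \<omega> * indicator (space M) \<omega> \<partial>M)"
    using nn_integral_Markov_inequality[of "W n" "space M" M "ennreal (1 / c)"] by simp
  also have "(\<integral>\<^sup>+\<omega>. W n \<omega> * indicator (space M) \<omega> \<partial>M) = (\<integral>\<^sup>+\<omega>. W n \<omega> \<partial>M)"
    by (intro nn_integral_cong) auto
  also have "ennreal (1 / c) * \<dots> \<le> ennreal (1 / c) * 1"
    using W[of n] by (intro mult_left_mono) auto
  finally show ?thesis by simp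
qed

text \<open>Off \<open>B\<close> the factor is 1. On \<open>B\<close> the step function
  decomposition reduces the claim to two lower sets: \<open>q \<le> a\<close> at a random level
  known in \<open>F\<close>, and \<open>q \<le> lam\<close> at a fixed level.
  \<open>mgf_sum_le\<close> then bounds the resulting mean.\<close>

lemma nn_integral_increment_le:
  fixes G :: "'a \<Rightarrow> ennreal" and a q :: "'a \<Rightarrow> real"
  assumes M: "prob_space M" and F: "subalgebra M F"
    and q[measurable]: "q \<in> borel_measurable M" and q1: "\<And>\<omega>. \<omega> \<in> space M \<Longrightarrow> q \<omega> \<le> 1"
    and B[measurable]: "B \<in> sets M"
    and le: "\<And>t. t \<in> {0..1} \<Longrightarrow> AE \<omega> in M. cond_prob_given M F B {\<omega> \<in> space M. q \<omega> \<le> t} \<omega> \<le> t"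
    and a[measurable]: "a \<in> borel_measurable F" and a0: "\<And>\<omega>. \<omega> \<in> space M \<Longrightarrow> 0 \<le> a \<omega>"
    and \<theta>: "0 \<le> \<theta>" "\<theta> < 2" and lam: "0 \<le> lam" "lam < 1"
    and G[measurable]: "G \<in> borel_measurable F" and fin: "(\<integral>\<^sup>+\<omega>. G \<omega> \<partial>M) < \<infinity>"
  shows "(\<integral>\<^sup>+\<omega>. G \<omega> * ennreal (exp (indicator B \<omega> *
      (\<theta> * (of_bool (q \<omega> \<le> a \<omega>) - of_bool (q \<omega> > lam) * (a \<omega> / (1 - lam)))
        - \<theta>\<^sup>2 / (2 - \<theta>) * nu lam (a \<omega>)))) \<partial>M) \<le> (\<integral>\<^sup>+\<omega>. G \<omega> \<partial>M)"
proof -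
  interpret prob_space M by fact
  \<comment> \<open>Since \<open>q \<le> 1\<close>, clipping the level at 1 only increases the exponent.\<close>
  define b where "b \<omega> = min (a \<omega>) 1" for \<omega>
  have b[measurable]: "b \<in> borel_measurable F" unfolding b_def by measurable
  have b01: "0 \<le> b \<omega> \<and> b \<omega> \<le> 1" if "\<omega> \<in> space M" for \<omega>
    using a0[OF that] by (auto simp: b_def)
  have bM[measurable]: "b \<in> borel_measurable M" and GM[measurable]: "G \<in> borel_measurable M"
    by (auto intro: measurable_from_subalg[OF F])
  define g where "g = \<theta>\<^sup>2 / (2 - \<theta>)"
  have g: "0 \<le> g" using \<theta> by (simp add: g_def)
  \<comment> \<open>The compensator is folded into the three coefficients, so that their weighted
    sum in \<open>m_sum\<close> is at most 1 pointwise.\<close>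
  define \<Gamma> where "\<Gamma> \<omega> = exp (- g * nu lam (b \<omega>))" for \<omega>
  define m0 where "m0 \<omega> = \<Gamma> \<omega> * mgf_0 \<theta> lam (b \<omega>)" for \<omega>
  define mA where "mA \<omega> = \<Gamma> \<omega> * mgf_A \<theta> lam (b \<omega>)" for \<omega>
  define mL where "mL \<omega> = \<Gamma> \<omega> * mgf_L \<theta> lam (b \<omega>)" for \<omega>
  have m[measurable]: "m0 \<in> borel_measurable F" "mA \<in> borel_measurable F" "mL \<in> borel_measurable F"
    unfolding m0_def mA_def mL_def \<Gamma>_def nu_def mgf_0_def mgf_A_def mgf_L_def by measurable
  have mM[measurable]: "m0 \<in> borel_measurable M" "mA \<in> borel_measurable M" "mL \<in> borel_measurable M"
    by (auto intro: measurable_from_subalg[OF F])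
  have m_pos: "0 \<le> m0 \<omega>" "0 \<le> mA \<omega>" "0 \<le> mL \<omega>" if "\<omega> \<in> space M" for \<omega>
    using mgf_nonneg[OF \<theta>(1) _ lam(2), of "b \<omega>"] b01[OF that]
    by (auto simp: m0_def mA_def mL_def \<Gamma>_def)
  have mA_le: "mA \<omega> \<le> exp \<theta>" if "\<omega> \<in> space M" for \<omega>
  proof -
    have "0 \<le> g * nu lam (b \<omega>)" using g b01[OF that] lam by (intro mult_nonneg_nonneg nu_nonneg) auto
    then have "\<Gamma> \<omega> \<le> 1" by (simp add: \<Gamma>_def)
    then have "mA \<omega> \<le> 1 * exp \<theta>" unfolding mA_def
      using mgf_A_le[OF \<theta>(1) _ lam(2), of "b \<omega>"] mgf_nonneg(2)[OF \<theta>(1) _ lam(2), of "b \<omega>"] b01[OF that]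
      by (intro mult_mono) auto
    then show ?thesis by simp
  qed
  have m_sum: "m0 \<omega> + mA \<omega> * b \<omega> + mL \<omega> * lam \<le> 1" if "\<omega> \<in> space M" for \<omega>
  proof -
    have "m0 \<omega> + mA \<omega> * b \<omega> + mL \<omega> * lam
      = \<Gamma> \<omega> * (mgf_0 \<theta> lam (b \<omega>) + mgf_A \<theta> lam (b \<omega>) * b \<omega> + mgf_L \<theta> lam (b \<omega>) * lam)"
      by (simp add: m0_def mA_def mL_def algebra_simps)
    also have "\<dots> \<le> \<Gamma> \<omega> * exp (g * nu lam (b \<omega>))"
      unfolding g_def using b01[OF that] \<theta> lam by (intro mult_left_mono mgf_sum_le) (auto simp: \<Gamma>_def)
    also have "\<dots> = 1" by (simp add: \<Gamma>_def flip: exp_add)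
    finally show ?thesis .
  qed
  have exp_le: "exp (\<theta> * (of_bool (q \<omega> \<le> a \<omega>) - of_bool (q \<omega> > lam) * (a \<omega> / (1 - lam))) - g * nu lam (a \<omega>))
      \<le> m0 \<omega> + mA \<omega> * of_bool (q \<omega> \<le> b \<omega>) + mL \<omega> * of_bool (q \<omega> \<le> lam)" if w: "\<omega> \<in> space M" for \<omega>
  proof -
    have ba: "b \<omega> \<le> a \<omega>" and iff: "q \<omega> \<le> a \<omega> \<longleftrightarrow> q \<omega> \<le> b \<omega>" using q1[OF w] by (auto simp: b_def)
    have "\<theta> * (of_bool (q \<omega> \<le> a \<omega>) - of_bool (q \<omega> > lam) * (a \<omega> / (1 - lam))) - g * nu lam (a \<omega>)
      \<le> \<theta> * (of_bool (q \<omega> \<le> b \<omega>) - of_bool (q \<omega> > lam) * (b \<omega> / (1 - lam))) - g * nu lam (b \<omega>)"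
      unfolding iff using \<theta> g lam ba b01[OF w]
      by (intro diff_mono mult_left_mono nu_mono divide_right_mono) auto
    then have "exp (\<theta> * (of_bool (q \<omega> \<le> a \<omega>) - of_bool (q \<omega> > lam) * (a \<omega> / (1 - lam))) - g * nu lam (a \<omega>))
      \<le> exp (\<theta> * (of_bool (q \<omega> \<le> b \<omega>) - of_bool (q \<omega> > lam) * (b \<omega> / (1 - lam)))) * \<Gamma> \<omega>"
      by (simp add: \<Gamma>_def flip: exp_add)
    also have "\<dots> = m0 \<omega> + mA \<omega> * of_bool (q \<omega> \<le> b \<omega>) + mL \<omega> * of_bool (q \<omega> \<le> lam)"
      unfolding exp_increment_eq[OF lam] m0_def mA_def mL_def by (simp add: algebra_simps)
    finally show ?thesis .
  qed
  let ?L = "{\<omega> \<in> space M. q \<omega> \<le> lam}"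
  let ?T0 = "\<lambda>\<omega>. G \<omega> * indicator (- B) \<omega> + G \<omega> * (ennreal (m0 \<omega>) * indicator B \<omega>)"
  have "(\<integral>\<^sup>+\<omega>. G \<omega> * ennreal (exp (indicator B \<omega> *
      (\<theta> * (of_bool (q \<omega> \<le> a \<omega>) - of_bool (q \<omega> > lam) * (a \<omega> / (1 - lam))) - g * nu lam (a \<omega>)))) \<partial>M)
    \<le> (\<integral>\<^sup>+\<omega>. ?T0 \<omega> + ((G \<omega> * ennreal (mA \<omega>)) * (of_bool (q \<omega> \<le> b \<omega>) * indicator B \<omega>)
        + (G \<omega> * ennreal (mL \<omega>)) * indicator (?L \<inter> B) \<omega>) \<partial>M)"
  proof (rule nn_integral_mono)
    fix \<omega> assume w: "\<omega> \<in> space M"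
    have "ennreal (exp (\<theta> * (of_bool (q \<omega> \<le> a \<omega>) - of_bool (q \<omega> > lam) * (a \<omega> / (1 - lam))) - g * nu lam (a \<omega>)))
      \<le> ennreal (m0 \<omega> + mA \<omega> * of_bool (q \<omega> \<le> b \<omega>) + mL \<omega> * of_bool (q \<omega> \<le> lam))"
      by (rule ennreal_leI[OF exp_le[OF w]])
    also have "\<dots> = ennreal (m0 \<omega>) + (ennreal (mA \<omega>) * of_bool (q \<omega> \<le> b \<omega>) + ennreal (mL \<omega>) * of_bool (q \<omega> \<le> lam))"
      using m_pos[OF w] by (auto simp: ac_simps)
    finally have *: "ennreal (exp (\<theta> * (of_bool (q \<omega> \<le> a \<omega>) - of_bool (q \<omega> > lam) * (a \<omega> / (1 - lam))) - g * nu lam (a \<omega>))) \<le> \<dots>" .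
    show "G \<omega> * ennreal (exp (indicator B \<omega> *
        (\<theta> * (of_bool (q \<omega> \<le> a \<omega>) - of_bool (q \<omega> > lam) * (a \<omega> / (1 - lam))) - g * nu lam (a \<omega>))))
      \<le> ?T0 \<omega> + ((G \<omega> * ennreal (mA \<omega>)) * (of_bool (q \<omega> \<le> b \<omega>) * indicator B \<omega>)
        + (G \<omega> * ennreal (mL \<omega>)) * indicator (?L \<inter> B) \<omega>)"
    proof (cases "\<omega> \<in> B")
      case True
      then show ?thesis
        using mult_left_mono[OF *, of "G \<omega>"] w by (auto simp: indicator_def distrib_left mult.assoc)
    qed simp
  qed
  also have "\<dots> = (\<integral>\<^sup>+\<omega>. ?T0 \<omega> \<partial>M)
      + ((\<integral>\<^sup>+\<omega>. (G \<omega> * ennreal (mA \<omega>)) * (of_bool (q \<omega> \<le> b \<omega>) * indicator B \<omega>) \<partial>M)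
        + (\<integral>\<^sup>+\<omega>. (G \<omega> * ennreal (mL \<omega>)) * indicator (?L \<inter> B) \<omega> \<partial>M))"
    by (simp add: nn_integral_add)
  also have "\<dots> \<le> (\<integral>\<^sup>+\<omega>. ?T0 \<omega> \<partial>M)
      + ((\<integral>\<^sup>+\<omega>. (G \<omega> * ennreal (mA \<omega>)) * (ennreal (b \<omega>) * indicator B \<omega>) \<partial>M)
        + (\<integral>\<^sup>+\<omega>. (G \<omega> * ennreal (mL \<omega>)) * (ennreal lam * indicator B \<omega>) \<partial>M))"
  proof (intro add_mono order_refl)
    show "(\<integral>\<^sup>+\<omega>. (G \<omega> * ennreal (mA \<omega>)) * (of_bool (q \<omega> \<le> b \<omega>) * indicator B \<omega>) \<partial>M)
      \<le> (\<integral>\<^sup>+\<omega>. (G \<omega> * ennreal (mA \<omega>)) * (ennreal (b \<omega>) * indicator B \<omega>) \<partial>M)"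
    proof (rule nn_integral_cond_prob_le_random[OF M F q B le b b01])
      have "(\<integral>\<^sup>+\<omega>. G \<omega> * ennreal (mA \<omega>) \<partial>M) \<le> (\<integral>\<^sup>+\<omega>. G \<omega> * ennreal (exp \<theta>) \<partial>M)"
        using mA_le by (intro nn_integral_mono mult_left_mono ennreal_leI) auto
      also have "\<dots> < \<infinity>" using fin by (simp add: nn_integral_multc ennreal_mult_less_top)
      finally show "(\<integral>\<^sup>+\<omega>. G \<omega> * ennreal (mA \<omega>) \<partial>M) < \<infinity>" .
    qed auto
    show "(\<integral>\<^sup>+\<omega>. (G \<omega> * ennreal (mL \<omega>)) * indicator (?L \<inter> B) \<omega> \<partial>M)
      \<le> (\<integral>\<^sup>+\<omega>. (G \<omega> * ennreal (mL \<omega>)) * (ennreal lam * indicator B \<omega>) \<partial>M)"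
      using lam by (intro nn_integral_cond_prob_le[OF M F] le) auto
  qed
  also have "\<dots> = (\<integral>\<^sup>+\<omega>. ?T0 \<omega> + ((G \<omega> * ennreal (mA \<omega>)) * (ennreal (b \<omega>) * indicator B \<omega>)
        + (G \<omega> * ennreal (mL \<omega>)) * (ennreal lam * indicator B \<omega>)) \<partial>M)"
    by (simp add: nn_integral_add)
  also have "\<dots> \<le> (\<integral>\<^sup>+\<omega>. G \<omega> \<partial>M)"
  proof (rule nn_integral_mono)
    fix \<omega> assume w: "\<omega> \<in> space M"
    have "ennreal (m0 \<omega>) + (ennreal (mA \<omega>) * ennreal (b \<omega>) + ennreal (mL \<omega>) * ennreal lam)
      = ennreal (m0 \<omega> + mA \<omega> * b \<omega> + mL \<omega> * lam)"
      using m_pos[OF w] b01[OF w] lam by (simp add: ennreal_mult ac_simps)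
    also have "\<dots> \<le> 1" using m_sum[OF w] by (simp add: ennreal_le_1)
    finally have "G \<omega> * (ennreal (m0 \<omega>) + (ennreal (mA \<omega>) * ennreal (b \<omega>) + ennreal (mL \<omega>) * ennreal lam)) \<le> G \<omega> * 1"
      by (rule mult_left_mono) simp
    then show "?T0 \<omega> + ((G \<omega> * ennreal (mA \<omega>)) * (ennreal (b \<omega>) * indicator B \<omega>)
        + (G \<omega> * ennreal (mL \<omega>)) * (ennreal lam * indicator B \<omega>)) \<le> G \<omega>"
      by (auto simp: indicator_def distrib_left mult.assoc)
  qed
  finally show ?thesis unfolding g_def .
qed

section \<open>Splitting \<open>\<delta>\<close> over the dyadic blocks\<close>

text \<open>The squares \<open>1/(1 + j)^2\<close> sum to \<open>kappa\<close> and block 0 gets one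
  extra unit, hence the normalisation \<open>1 + kappa\<close>. The logarithm
  \<open>- ln (budget \<delta> j)\<close> is the counterpart of \<open>eps\<close> with
  \<open>1 + j\<close> in place of \<open>1 + log 2 u\<close>, lowered by \<open>ln 2\<close> on
  block 0.\<close>

definition budget :: "real \<Rightarrow> nat \<Rightarrow> real" where
  "budget \<delta> j = \<delta> / (1 + kappa) * (if j = 0 then 2 else 1 / (1 + real j)\<^sup>2)"

text \<open>Makes \<open>2 / (1 + kappa)\<close> less than 1, so even the doubled share of block 0
  stays below 1 and its negative logarithm is positive.\<close>

lemma kappa_gt_1: "1 < kappa"
proof -
  have "3 * 3 < pi * pi" using pi_gt3 by (intro mult_strict_mono) auto
  then show ?thesis by (simp add: kappa_def power2_eq_square)
qed

lemma budget_sums: "budget \<delta> sums \<delta>"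
proof -
  have "(\<lambda>j. 1 / (1 + real j)\<^sup>2 + (if j = 0 then 1 else 0)) sums (kappa + 1)"
    using sums_add[OF inverse_squares_sums sums_single[of 0 "\<lambda>_. 1::real"]]
    by (simp add: kappa_def add.commute)
  then have "(\<lambda>j. \<delta> / (1 + kappa) * (1 / (1 + real j)\<^sup>2 + (if j = 0 then 1 else 0))) sums (\<delta> / (1 + kappa) * (kappa + 1))"
    by (rule sums_mult)
  moreover have "(\<lambda>j. \<delta> / (1 + kappa) * (1 / (1 + real j)\<^sup>2 + (if j = 0 then 1 else 0))) = budget \<delta>"
    by (auto simp: budget_def fun_eq_iff)
  moreover have "\<delta> / (1 + kappa) * (kappa + 1) = \<delta>" using kappa_gt_1 by (simp add: field_simps)
  ultimately show ?thesis by metis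
qed

lemma budget_pos: "0 < \<delta> \<Longrightarrow> 0 < budget \<delta> j"
  using kappa_gt_1 by (auto simp: budget_def intro!: divide_pos_pos mult_pos_pos)

lemma log_budget_0:
  assumes "0 < \<delta>"
  shows "- ln (budget \<delta> 0) = ln ((1 + kappa) / \<delta>) - ln 2"
  using assms kappa_gt_1 by (simp add: budget_def ln_div ln_mult)

lemma log_budget_pos:
  assumes "0 < \<delta>" "0 < j"
  shows "- ln (budget \<delta> j) = ln ((1 + kappa) / \<delta>) + 2 * ln (1 + real j)"
  using assms kappa_gt_1 by (simp add: budget_def ln_div ln_mult ln_realpow)

lemma budget_less_1:
  assumes "0 < \<delta>" "\<delta> < 1"
  shows "budget \<delta> j < 1"
proof -
  have "(if j = 0 then 2 else 1 / (1 + real j)\<^sup>2) \<le> 2"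
    by (auto simp: divide_simps power2_eq_square algebra_simps)
  then have "budget \<delta> j \<le> \<delta> / (1 + kappa) * 2"
    unfolding budget_def using assms kappa_gt_1 by (intro mult_left_mono) auto
  also have "\<dots> < 1" using assms kappa_gt_1 by (simp add: field_simps)
  finally show ?thesis .
qed

section \<open>Comparing the lines with \<open>Delta\<close>\<close>

text \<open>With \<open>e = - ln (budget \<delta> j)\<close>, the line
  \<open>x u / 2 + e / x\<close> lies above \<open>sqrt (2 e u)\<close> and touches it at
  \<open>u = 2 e / x^2\<close>. This choice of \<open>x\<close> puts the contact point at
  \<open>2^(j+1)\<close>.\<close>

definition slope :: "real \<Rightarrow> nat \<Rightarrow> real" where
  "slope \<delta> j = sqrt (- ln (budget \<delta> j) / 2 ^ j)"

lemma slope_pos: "0 < \<delta> \<Longrightarrow> \<delta> < 1 \<Longrightarrow> 0 < slope \<delta> j"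
  using budget_pos[of \<delta> j] budget_less_1[of \<delta> j] by (simp add: slope_def divide_neg_pos)

text \<open>To be read with \<open>r = sqrt e\<close>, \<open>w = sqrt (2^j)\<close> and
  \<open>y = sqrt u\<close>. The claim amounts to \<open>(y - w) * (y - 2 * w) \<le> 0\<close>, with
  equality at both ends, which is where the constant \<open>3/2\<close> comes from.\<close>

lemma line_le_sqrt:
  fixes r w y :: real
  assumes "0 \<le> r" "0 < w" "w \<le> y" "y \<le> 2 * w"
  shows "r / w / 2 * y\<^sup>2 + r * w \<le> 3 / 2 * r * y"
proof -
  have "(y - w) * (y - 2 * w) \<le> 0" using assms by (intro mult_nonneg_nonpos) auto
  then have "r * (y\<^sup>2 + 2 * w\<^sup>2) \<le> r * (3 * y * w)"
    using assms by (intro mult_left_mono) (auto simp: power2_eq_square algebra_simps)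
  then show ?thesis using assms by (simp add: field_simps power2_eq_square)
qed

lemma slope_line_le:
  assumes "0 < \<delta>" "\<delta> < 1" "2 ^ j \<le> u" "u \<le> 4 * 2 ^ j"
  shows "slope \<delta> j / 2 * u + - ln (budget \<delta> j) / slope \<delta> j
    \<le> 3 / 2 * sqrt (- ln (budget \<delta> j)) * sqrt u"
proof -
  define e where "e = - ln (budget \<delta> j)"
  have e: "0 < e" using budget_pos[of \<delta> j] budget_less_1[of \<delta> j] assms by (simp add: e_def)
  have u: "0 \<le> u" using assms(3) by (rule order_trans[rotated]) simp
  have sl: "slope \<delta> j = sqrt e / sqrt (2 ^ j)" by (simp add: slope_def e_def flip: real_sqrt_divide)
  have "sqrt u \<le> sqrt (4 * 2 ^ j)" using assms by simp
  then have "sqrt u \<le> 2 * sqrt (2 ^ j)" by (simp add: real_sqrt_mult)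
  then have "sqrt e / sqrt (2 ^ j) / 2 * (sqrt u)\<^sup>2 + sqrt e * sqrt (2 ^ j) \<le> 3 / 2 * sqrt e * sqrt u"
    using assms e by (intro line_le_sqrt) auto
  moreover have "e / slope \<delta> j = sqrt e * sqrt (2 ^ j)"
    using e real_div_sqrt[of e] by (simp add: sl field_simps)
  ultimately show ?thesis using u by (simp add: sl e_def)
qed

lemma Delta_ge_lines:
  assumes \<delta>: "0 < \<delta>" "\<delta> < 1" and u: "0 \<le> u"
    and s: "\<And>j. s \<le> slope \<delta> j / 2 * u + - ln (budget \<delta> j) / slope \<delta> j + - ln (budget \<delta> j) / 2"
  shows "s + 1 \<le> Delta \<delta> u"
proof (cases "u < 2")
  case True
  define e where "e = - ln (budget \<delta> 0)"
  have e: "0 < e" using budget_pos[of \<delta> 0] budget_less_1[of \<delta> 0] \<delta> by (simp add: e_def)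
  have ln2: "2 / 3 \<le> ln (2::real)" by (rule ln2_ge_two_thirds)
  have "0 \<le> ln (1 + log 2 (max u 1))" by (intro ln_ge_zero) (simp add: zero_le_log_cancel_iff)
  then have eps: "e + ln 2 \<le> eps \<delta> u"
    unfolding e_def log_budget_0[OF \<delta>(1)] eps_def by simp
  \<comment> \<open>The line increases in \<open>u\<close>, so below 1 it may be evaluated at 1,
    just as \<open>Delta\<close> is.\<close>
  have "slope \<delta> 0 / 2 * u \<le> slope \<delta> 0 / 2 * max u 1"
    using slope_pos[OF \<delta>, of 0] by (intro mult_left_mono) auto
  moreover have "slope \<delta> 0 / 2 * max u 1 + e / slope \<delta> 0 \<le> 3 / 2 * sqrt e * sqrt (max u 1)"
    unfolding e_def using True by (intro slope_line_le[OF \<delta>]) auto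
  ultimately have s1: "s \<le> 3 / 2 * sqrt e * sqrt (max u 1) + e / 2"
    using s[of 0] unfolding e_def by linarith
  \<comment> \<open>The value \<open>7/10\<close> is enough: the terms \<open>eps / 2\<close> and
    \<open>e / 2\<close> differ by at least \<open>ln 2 / 2\<close>, hence by at least
    \<open>1/3\<close>, and \<open>7/10 + 1/3\<close> exceeds 1. The square
    \<open>(sqrt e - 3/5)^2\<close> is chosen so that the linear term splits into
    \<open>7/4 e\<close> and a constant, completing \<open>9/4 e\<close> to
    \<open>4 e\<close>.\<close>
  have gap: "3 / 2 * sqrt e + 7 / 10 \<le> 2 * sqrt (eps \<delta> u)"
  proof -
    have "(3 / 2 * sqrt e + 7 / 10)\<^sup>2 \<le> 4 * eps \<delta> u"
    proof -
      have "0 \<le> (sqrt e - 3 / 5)\<^sup>2" by simp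
      then have "21 / 10 * sqrt e \<le> 7 / 4 * e + 63 / 100"
        using e by (simp add: power2_eq_square algebra_simps)
      moreover have "(3 / 2 * sqrt e + 7 / 10)\<^sup>2 = 9 / 4 * e + 21 / 10 * sqrt e + 49 / 100"
        using e by (simp add: power2_eq_square algebra_simps)
      ultimately show ?thesis using eps ln2 by linarith
    qed
    then have "3 / 2 * sqrt e + 7 / 10 \<le> sqrt (4 * eps \<delta> u)" by (rule real_le_rsqrt)
    then show ?thesis by (simp add: real_sqrt_mult)
  qed
  have "1 * (7 / 10) \<le> sqrt (max u 1) * (2 * sqrt (eps \<delta> u) - 3 / 2 * sqrt e)"
    using gap by (intro mult_mono) auto
  then show ?thesis using s1 eps ln2 unfolding Delta_def by (simp add: algebra_simps)
next
  case False
  define j where "j = nat \<lfloor>log 2 u\<rfloor>"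
  have log1: "1 \<le> log 2 u" using False by (subst le_log_iff) auto
  then have j: "real j \<le> log 2 u" "log 2 u < real j + 1" "1 \<le> j"
    unfolding j_def by (auto simp: le_nat_iff le_floor_iff)
  have u2: "2 ^ j \<le> u" "u \<le> 2 * 2 ^ j"
    using j False by (auto simp: le_log_iff log_less_iff powr_realpow powr_add)
  define e where "e = - ln (budget \<delta> j)"
  have eps: "e \<le> eps \<delta> u"
    unfolding e_def eps_def using j False \<delta> by (subst log_budget_pos) auto
  \<comment> \<open>In fact \<open>e\<close> is at least \<open>3 ln 2\<close>: one
    \<open>ln 2\<close> from \<open>(1 + kappa) / \<delta> \<ge> 2\<close> and two from
    \<open>j \<ge> 1\<close>.\<close>
  have "2 \<le> e"
  proof -
    have "ln 2 \<le> ln ((1 + kappa) / \<delta>)"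
      using kappa_gt_1 \<delta> by (subst ln_le_cancel_iff) (auto simp: field_simps)
    moreover have "ln 2 \<le> ln (1 + real j)" using j by simp
    ultimately show ?thesis
      using ln2_ge_two_thirds log_budget_pos[OF \<delta>(1), of j] j(3) unfolding e_def by linarith
  qed
  have s1: "s \<le> 3 / 2 * sqrt e * sqrt u + e / 2"
    using s[of j] slope_line_le[OF \<delta> u2(1)] u2(2) u unfolding e_def by linarith
  \<comment> \<open>Passing from the constant \<open>3/2\<close> to 2 gains at least half of
    \<open>sqrt e * sqrt u\<close>, which is at least 1.\<close>
  have "sqrt 2 * sqrt 2 \<le> sqrt e * sqrt u"
    using \<open>2 \<le> e\<close> False by (intro mult_mono) auto
  moreover have "sqrt e * sqrt u \<le> sqrt (eps \<delta> u) * sqrt u"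
    using eps u by (intro mult_right_mono) auto
  moreover have "max u 1 = u" "sqrt 2 * sqrt 2 = (2::real)" using False by auto
  ultimately show ?thesis
    using s1 eps unfolding Delta_def by (simp only:)
qed

section \<open>The maximal inequality along the index set\<close>

lemma hyp_index_mono: "k \<in> hyp_index m \<Longrightarrow> 1 \<le> i \<Longrightarrow> i \<le> k \<Longrightarrow> i \<in> hyp_index m"
  unfolding hyp_index_def by (auto intro: order_trans[of "enat i" "enat k"])

text \<open>Continuity from below along growing prefixes of the index set, which covers finite and
  infinite \<open>m\<close> at once. Each prefix is empty or of the form \<open>{1..N}\<close>, with
  \<open>N\<close> smaller than \<open>n\<close> when \<open>m\<close> is.\<close>

lemma emeasure_ex_le_of_prefix:
  fixes P :: "nat \<Rightarrow> 'a \<Rightarrow> bool"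
  assumes meas: "\<And>k. k \<in> hyp_index m \<Longrightarrow> {\<omega> \<in> space M. P k \<omega>} \<in> sets M"
    and le: "\<And>n. n \<in> hyp_index m \<Longrightarrow> emeasure M {\<omega> \<in> space M. \<exists>k\<in>{1..n}. P k \<omega>} \<le> b"
  shows "emeasure M {\<omega> \<in> space M. \<exists>k\<in>hyp_index m. P k \<omega>} \<le> b"
proof -
  define E where "E n = {\<omega> \<in> space M. \<exists>k\<in>hyp_index m \<inter> {..n}. P k \<omega>}" for n
  have E_eq: "E n = (\<Union>k\<in>hyp_index m \<inter> {..n}. {\<omega> \<in> space M. P k \<omega>})" for n by (auto simp: E_def)
  have E: "E n \<in> sets M" for n
    unfolding E_eq by (intro sets.finite_UN) (auto intro: meas)
  have En: "emeasure M (E n) \<le> b" for n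
  proof (cases "hyp_index m \<inter> {..n} = {}")
    case True
    then show ?thesis by (simp add: E_def)
  next
    case False
    define N where "N = Max (hyp_index m \<inter> {..n})"
    have N: "N \<in> hyp_index m \<inter> {..n}" unfolding N_def using False by (intro Max_in) auto
    have eq: "hyp_index m \<inter> {..n} = {1..N}"
    proof (intro equalityI subsetI)
      fix k assume "k \<in> hyp_index m \<inter> {..n}"
      then show "k \<in> {1..N}" unfolding N_def by (auto simp: hyp_index_def)
    next
      fix k assume "k \<in> {1..N}"
      then show "k \<in> hyp_index m \<inter> {..n}" using N hyp_index_mono[of N m k] by auto
    qed
    show ?thesis unfolding E_def eq by (rule le) (use N in blast)
  qed
  have "{\<omega> \<in> space M. \<exists>k\<in>hyp_index m. P k \<omega>} = (\<Union>n. E n)" by (auto simp: E_def)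
  also have "emeasure M \<dots> = (SUP n. emeasure M (E n))"
    using E by (intro SUP_emeasure_incseq[symmetric]) (auto simp: incseq_def E_def)
  also have "\<dots> \<le> b" by (intro SUP_least En)
  finally show ?thesis .
qed

text \<open>The level \<open>a k\<close> is known one step ahead, while \<open>B k\<close> and the
  two comparisons are known only at time \<open>k\<close>; the increments are therefore adapted with
  predictable levels. Starting at 2 leaves time 1 as the initial sigma-algebra of Ville's
  inequality.\<close>

lemma ville_increments:
  fixes F :: "nat \<Rightarrow> 'a measure" and q a :: "nat \<Rightarrow> 'a \<Rightarrow> real" and B :: "nat \<Rightarrow> 'a set"
  defines "Y \<theta> lam k \<omega> \<equiv> indicator (B k) \<omega> *
      (\<theta> * (of_bool (q k \<omega> \<le> a k \<omega>) - of_bool (q k \<omega> > lam) * (a k \<omega> / (1 - lam)))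
        - \<theta>\<^sup>2 / (2 - \<theta>) * nu lam (a k \<omega>))"
  assumes M: "prob_space M"
    and F: "\<And>k. k \<in> hyp_index m \<Longrightarrow> subalgebra M (F k)"
    and mono: "\<And>k. 1 \<le> k \<Longrightarrow> Suc k \<in> hyp_index m \<Longrightarrow> sets (F k) \<subseteq> sets (F (Suc k))"
    and q: "\<And>k. k \<in> hyp_index m \<Longrightarrow> q k \<in> borel_measurable M"
    and q1: "\<And>k \<omega>. k \<in> hyp_index m \<Longrightarrow> \<omega> \<in> space M \<Longrightarrow> q k \<omega> \<le> 1"
    and qa: "\<And>k. k \<in> hyp_index m \<Longrightarrow> {\<omega> \<in> space M. q k \<omega> \<le> a k \<omega>} \<in> sets (F k)"
    and ql: "\<And>k. k \<in> hyp_index m \<Longrightarrow> {\<omega> \<in> space M. lam < q k \<omega>} \<in> sets (F k)"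
    and B: "\<And>k. k \<in> hyp_index m \<Longrightarrow> B k \<in> sets (F k)"
    and a: "\<And>k. k \<in> hyp_index m \<Longrightarrow> 2 \<le> k \<Longrightarrow> a k \<in> borel_measurable (F (k - 1))"
    and a0: "\<And>k \<omega>. k \<in> hyp_index m \<Longrightarrow> \<omega> \<in> space M \<Longrightarrow> 0 \<le> a k \<omega>"
    and le: "\<And>k t. k \<in> hyp_index m \<Longrightarrow> 2 \<le> k \<Longrightarrow> t \<in> {0..1} \<Longrightarrow>
      AE \<omega> in M. cond_prob_given M (F (k - 1)) (B k) {\<omega> \<in> space M. q k \<omega> \<le> t} \<omega> \<le> t"
    and \<theta>: "0 \<le> \<theta>" "\<theta> < 2" and lam: "0 \<le> lam" "lam < 1" and c: "0 < c"
  shows "{\<omega> \<in> space M. \<exists>k\<in>hyp_index m. ln c \<le> (\<Sum>i=2..k. Y \<theta> lam i \<omega>)} \<in> sets M" (is "?E \<in> _")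
    and "emeasure M {\<omega> \<in> space M. \<exists>k\<in>hyp_index m. ln c \<le> (\<Sum>i=2..k. Y \<theta> lam i \<omega>)} \<le> ennreal (1 / c)"
proof -
  have Y: "Y \<theta> lam k \<in> borel_measurable (F k)" if k: "k \<in> hyp_index m" "2 \<le> k" for k
  proof -
    have k1: "k - 1 \<in> hyp_index m" using k by (intro hyp_index_mono[OF k(1)]) auto
    have sp: "space (F k) = space M" "space (F (k - 1)) = space M"
      using F[OF k(1)] F[OF k1] by (auto simp: subalgebra_def)
    have [measurable]: "a k \<in> borel_measurable (F k)"
      using measurable_from_subalg[of "F k" "F (k - 1)", OF _ a[OF k]] mono[of "k - 1"] k sp
      by (auto simp: subalgebra_def)
    have [measurable]: "B k \<in> sets (F k)" "Measurable.pred (F k) (\<lambda>\<omega>. q k \<omega> \<le> a k \<omega>)"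
      "Measurable.pred (F k) (\<lambda>\<omega>. lam < q k \<omega>)"
      using B[OF k(1)] qa[OF k(1)] ql[OF k(1)] by (auto simp: pred_def sp)
    show ?thesis unfolding Y_def nu_def by measurable
  qed
  have YM: "Y \<theta> lam k \<in> borel_measurable M" if "k \<in> hyp_index m" "2 \<le> k" for k
    by (rule measurable_from_subalg[OF F[OF that(1)] Y[OF that]])
  have sumM: "(\<lambda>\<omega>. \<Sum>i=2..k. Y \<theta> lam i \<omega>) \<in> borel_measurable M" if "k \<in> hyp_index m" for k
    by (intro borel_measurable_sum YM) (auto intro: hyp_index_mono[OF that])
  have meas: "{\<omega> \<in> space M. ln c \<le> (\<Sum>i=2..k. Y \<theta> lam i \<omega>)} \<in> sets M" if "k \<in> hyp_index m" for k
    using sumM[OF that] by measurable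
  have "?E = (\<Union>k\<in>hyp_index m. {\<omega> \<in> space M. ln c \<le> (\<Sum>i=2..k. Y \<theta> lam i \<omega>)})" by auto
  then show "?E \<in> sets M" using meas by auto
  have "emeasure M {\<omega> \<in> space M. \<exists>k\<in>{1..n}. ln c \<le> (\<Sum>i=2..k. Y \<theta> lam i \<omega>)} \<le> ennreal (1 / c)"
    if n: "n \<in> hyp_index m" for n
  proof -
    \<comment> \<open>Ville's time 0 is time 1 here, so factor \<open>i\<close> belongs to step
      \<open>i + 2\<close> and is tested against functions known at time
      \<open>i + 1\<close>.\<close>
    define Z where "Z i \<omega> = ennreal (exp (Y \<theta> lam (i + 2) \<omega>))" for i \<omega>
    have n1: "1 \<le> n" using n by (auto simp: hyp_index_def)
    have idx: "i + 2 \<in> hyp_index m" "Suc i \<in> hyp_index m" if "i < n - 1" for i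
      using that by (auto intro!: hyp_index_mono[OF n])
    have prodZ: "(\<Prod>i<l. Z i \<omega>) = ennreal (exp (\<Sum>i=2..Suc l. Y \<theta> lam i \<omega>))" for l \<omega>
    proof (induction l)
      case (Suc l)
      have "(\<Sum>i=2..Suc (Suc l). Y \<theta> lam i \<omega>) = (\<Sum>i=2..Suc l. Y \<theta> lam i \<omega>) + Y \<theta> lam (l + 2) \<omega>"
        by simp
      then show ?case using Suc by (simp add: Z_def exp_add ennreal_mult)
    qed simp
    have "emeasure M {\<omega> \<in> space M. \<exists>k\<le>n - 1. ennreal c \<le> (\<Prod>i<k. Z i \<omega>)} \<le> ennreal (1 / c)"
    proof (rule ville_inequality[OF M c, where F = "\<lambda>i. F (Suc i)"])
      show "subalgebra M (F (Suc i))" if "i \<le> n - 1" for i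
        using that n1 by (intro F hyp_index_mono[OF n]) auto
      show "sets (F (Suc i)) \<subseteq> sets (F (Suc (Suc i)))" if "i < n - 1" for i
        using idx[OF that] by (intro mono) auto
      show "Z i \<in> borel_measurable (F (Suc (Suc i)))" if "i < n - 1" for i
        using Y[of "i + 2"] idx[OF that] unfolding Z_def by simp
      show "(\<integral>\<^sup>+\<omega>. G \<omega> * Z i \<omega> \<partial>M) \<le> (\<integral>\<^sup>+\<omega>. G \<omega> \<partial>M)"
        if i: "i < n - 1" and G: "G \<in> borel_measurable (F (Suc i))" "(\<integral>\<^sup>+\<omega>. G \<omega> \<partial>M) < \<infinity>" for i G
      proof -
        note k = idx(1)[OF i]
        have "B (i + 2) \<in> sets M" using B[OF k] F[OF k] by (auto simp: subalgebra_def)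
        then show ?thesis
          unfolding Z_def Y_def
          using le[OF k] a[OF k] G
          by (intro nn_integral_increment_le[OF M F[OF idx(2)[OF i]] q[OF k] q1[OF k] _ _ _ a0[OF k] \<theta> lam]) auto
      qed
    qed
    moreover have "(\<exists>k\<in>{1..n}. ln c \<le> (\<Sum>i=2..k. Y \<theta> lam i \<omega>))
        \<longleftrightarrow> (\<exists>k\<le>n - 1. ennreal c \<le> (\<Prod>i<k. Z i \<omega>))" for \<omega>
    proof -
      have "ln c \<le> x \<longleftrightarrow> ennreal c \<le> ennreal (exp x)" for x
        using c by (metis ennreal_le_iff exp_ge_zero exp_le_cancel_iff exp_ln)
      moreover have "{1..n} = Suc ` {..n - 1}"
        using n1 by (cases n) (simp_all add: image_Suc_atMost)
      ultimately show ?thesis by (simp only: prodZ bex_simps Bex_def image_iff atMost_iff) blast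
    qed
    ultimately show ?thesis by simp
  qed
  then show "emeasure M ?E \<le> ennreal (1 / c)"
    by (intro emeasure_ex_le_of_prefix meas)
qed

section \<open>Events of the filtration\<close>

lemma space_pval_filtration [simp]: "space (pval_filtration M p \<pi> \<alpha> lam k) = space M"
  unfolding pval_filtration_def by (rule space_measure_of) auto

lemma sets_pval_filtration:
  "sets (pval_filtration M p \<pi> \<alpha> lam k) = sigma_sets (space M)
     ({{\<omega> \<in> space M. \<pi> i \<omega> = j} | i j. i \<in> {1..k}}
      \<union> {{\<omega> \<in> space M. p (\<pi> i \<omega>) \<omega> \<le> \<alpha> i \<omega>} | i. i \<in> {1..k}}
      \<union> {{\<omega> \<in> space M. p (\<pi> i \<omega>) \<omega> > lam} | i. i \<in> {1..k}})"
  unfolding pval_filtration_def by (rule sets_measure_of) auto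

lemma sets_pval_filtration_mono:
  "k \<le> l \<Longrightarrow> sets (pval_filtration M p \<pi> \<alpha> lam k) \<subseteq> sets (pval_filtration M p \<pi> \<alpha> lam l)"
  unfolding sets_pval_filtration by (intro sigma_sets_mono') fastforce

lemma pval_filtration_events:
  assumes "1 \<le> k"
  shows "{\<omega> \<in> space M. \<pi> k \<omega> = j} \<in> sets (pval_filtration M p \<pi> \<alpha> lam k)"
    and "{\<omega> \<in> space M. p (\<pi> k \<omega>) \<omega> \<le> \<alpha> k \<omega>} \<in> sets (pval_filtration M p \<pi> \<alpha> lam k)"
    and "{\<omega> \<in> space M. lam < p (\<pi> k \<omega>) \<omega>} \<in> sets (pval_filtration M p \<pi> \<alpha> lam k)"
  using assms unfolding sets_pval_filtration by (auto intro!: sigma_sets.Basic)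

section \<open>Assembling the uniform bound\<close>

theorem theorem38:
  fixes M :: "'a measure" and N :: "'x measure" and X :: "'a \<Rightarrow> 'x"
    and m :: enat and H :: "nat \<Rightarrow> 'x measure set"
    and p :: "nat \<Rightarrow> 'a \<Rightarrow> real" and \<pi> :: "nat \<Rightarrow> 'a \<Rightarrow> nat" and \<alpha> :: "nat \<Rightarrow> 'a \<Rightarrow> real"
    and lam \<delta> :: real
  defines "\<F> \<equiv> pval_filtration M p \<pi> \<alpha> lam"
    and "h \<equiv> null_status (distr M N X) H"
  assumes "prob_space M" and "X \<in> measurable M N"
    and "\<And>i. i \<in> hyp_index m \<Longrightarrow> p i \<in> borel_measurable (vimage_algebra (space M) X N)"
    and "\<And>i \<omega>. i \<in> hyp_index m \<Longrightarrow> \<omega> \<in> space M \<Longrightarrow> p i \<omega> \<in> {0..1}"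
    and "\<And>i. i \<in> hyp_index m \<Longrightarrow>
           \<pi> i \<in> measurable (vimage_algebra (space M) X N) (count_space UNIV)"
    and "\<And>i \<omega>. i \<in> hyp_index m \<Longrightarrow> \<omega> \<in> space M \<Longrightarrow> \<pi> i \<omega> \<in> hyp_index m"
    and "\<And>\<omega>. \<omega> \<in> space M \<Longrightarrow> inj_on (\<lambda>i. \<pi> i \<omega>) (hyp_index m)"
    and "\<And>i. i \<in> hyp_index m \<Longrightarrow> \<alpha> i \<in> borel_measurable (vimage_algebra (space M) X N)"
    and "\<And>i \<omega>. i \<in> hyp_index m \<Longrightarrow> \<omega> \<in> space M \<Longrightarrow> 0 \<le> \<alpha> i \<omega>"
    and "0 \<le> lam" and "lam < 1"
    and "\<And>k. k \<in> hyp_index m \<Longrightarrow> 2 \<le> k \<Longrightarrow> \<alpha> k \<in> borel_measurable (\<F> (k - 1))"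
    and "\<And>k t. k \<in> hyp_index m \<Longrightarrow> 2 \<le> k \<Longrightarrow> t \<in> {0..1} \<Longrightarrow>
           AE \<omega> in M. cond_prob_given M (\<F> (k - 1))
             {\<omega> \<in> space M. h (\<pi> k \<omega>) = 0} {\<omega> \<in> space M. p (\<pi> k \<omega>) \<omega> \<le> t} \<omega> \<le> t"
    and "0 < \<delta>" and "\<delta> < 1"
  shows "\<P>(\<omega> in M. \<forall>k \<in> hyp_index m.
             (\<Sum>i=1..k. (1 - h (\<pi> i \<omega>)) * of_bool (p (\<pi> i \<omega>) \<omega> \<le> \<alpha> i \<omega>))
               \<le> Vbar h p \<pi> \<alpha> lam \<delta> k \<omega>) \<ge> 1 - \<delta>"
proof -
  interpret prob_space M by fact
  note \<delta> = assms(16,17) and lam = assms(12,13)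
  have X: "subalgebra M (vimage_algebra (space M) X N)"
    using assms(4) measurable_space[OF assms(4)]
    by (auto simp: subalgebra_def sets_vimage_algebra2 Pi_iff)
  have pM: "p i \<in> borel_measurable M" and \<pi>M: "\<pi> i \<in> measurable M (count_space UNIV)"
    and \<alpha>M: "\<alpha> i \<in> borel_measurable M" if "i \<in> hyp_index m" for i
    using assms(5,7,10)[OF that] by (auto intro: measurable_from_subalg[OF X])
  define q where "q k \<omega> = p (\<pi> k \<omega>) \<omega>" for k \<omega>
  define B where "B k = {\<omega> \<in> space M. h (\<pi> k \<omega>) = 0}" for k
  have hB: "1 - h (\<pi> k \<omega>) = indicator (B k) \<omega>" if "\<omega> \<in> space M" for k \<omega>
    using that by (auto simp: B_def h_def null_status_def)
  \<comment> \<open>A p-value at a random index is measurable because the index takes countably many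
    values.\<close>
  have qM: "q k \<in> borel_measurable M" if k: "k \<in> hyp_index m" for k
  proof -
    have "\<pi> k \<in> measurable M (count_space (hyp_index m))"
      using \<pi>M[OF k] assms(8)[OF k] by (auto simp: measurable_count_space_eq2_countable)
    then show ?thesis unfolding q_def by (intro measurable_compose_countable'[OF pM]) auto
  qed
  have \<F>: "subalgebra M (\<F> k)" if k: "k \<in> hyp_index m" for k
  proof -
    have "{\<omega> \<in> space M. \<pi> i \<omega> = j} \<in> sets M \<and> {\<omega> \<in> space M. q i \<omega> \<le> \<alpha> i \<omega>} \<in> sets M
      \<and> {\<omega> \<in> space M. lam < q i \<omega>} \<in> sets M" if "i \<in> {1..k}" for i j
    proof -
      have i: "i \<in> hyp_index m" using that by (auto intro: hyp_index_mono[OF k])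
      note [measurable] = \<pi>M[OF i] qM[OF i] \<alpha>M[OF i]
      show ?thesis by (intro conjI) measurable
    qed
    then show ?thesis
      unfolding subalgebra_def \<F>_def sets_pval_filtration q_def
      by (intro conjI sets.sigma_sets_subset) auto
  qed
  \<comment> \<open>The status \<open>h\<close> is deterministic, so the event depends on the
    integer \<open>\<pi> k\<close> alone, which is among the generators.\<close>
  have B\<F>: "B k \<in> sets (\<F> k)" if "k \<in> hyp_index m" for k
  proof -
    have "B k = (\<Union>j\<in>{j. h j = 0}. {\<omega> \<in> space M. \<pi> k \<omega> = j})" by (auto simp: B_def)
    also have "\<dots> \<in> sets (\<F> k)"
      unfolding \<F>_def using that
      by (intro sets.countable_UN') (auto simp: hyp_index_def intro!: pval_filtration_events)
    finally show ?thesis .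
  qed
  define D where "D k \<omega> = of_bool (q k \<omega> \<le> \<alpha> k \<omega>) - of_bool (q k \<omega> > lam) * (\<alpha> k \<omega> / (1 - lam))" for k \<omega>
  \<comment> \<open>Solves \<open>\<theta> / (2 - \<theta>) = x / 2\<close> for the slope parameter
    \<open>x\<close>. Dividing Ville's bound by \<open>\<theta>\<close> then gives slope
    \<open>x / 2\<close> and intercept \<open>e / \<theta> = e / x + e / 2\<close>.\<close>
  define \<theta> where "\<theta> j = 2 * slope \<delta> j / (2 + slope \<delta> j)" for j
  define Bad where "Bad j = {\<omega> \<in> space M. \<exists>k\<in>hyp_index m. ln (1 / budget \<delta> j) \<le>
      (\<Sum>i=2..k. indicator (B i) \<omega> * (\<theta> j * D i \<omega> - (\<theta> j)\<^sup>2 / (2 - \<theta> j) * nu lam (\<alpha> i \<omega>)))}" for j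
  have sl: "0 < slope \<delta> j" for j by (rule slope_pos[OF \<delta>])
  have \<theta>: "0 < \<theta> j" "\<theta> j < 2" for j using sl[of j] by (auto simp: \<theta>_def field_simps)
  have Bad: "Bad j \<in> sets M" "emeasure M (Bad j) \<le> ennreal (budget \<delta> j)" for j
  proof -
    have mono: "sets (\<F> k) \<subseteq> sets (\<F> (Suc k))" for k
      unfolding \<F>_def by (rule sets_pval_filtration_mono) simp
    have q1: "q k \<omega> \<le> 1" if "k \<in> hyp_index m" "\<omega> \<in> space M" for k \<omega>
      using assms(6)[OF assms(8)[OF that] that(2)] by (simp add: q_def)
    have qa: "{\<omega> \<in> space M. q k \<omega> \<le> \<alpha> k \<omega>} \<in> sets (\<F> k)"
      and ql: "{\<omega> \<in> space M. lam < q k \<omega>} \<in> sets (\<F> k)" if "k \<in> hyp_index m" for k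
      unfolding q_def \<F>_def using that by (auto simp: hyp_index_def intro!: pval_filtration_events)
    have le: "AE \<omega> in M. cond_prob_given M (\<F> (k - 1)) (B k) {\<omega> \<in> space M. q k \<omega> \<le> t} \<omega> \<le> t"
      if "k \<in> hyp_index m" "2 \<le> k" "t \<in> {0..1}" for k t
      using assms(15)[OF that] unfolding B_def q_def .
    have c: "0 < 1 / budget \<delta> j" using budget_pos[OF \<delta>(1)] by simp
    note V = ville_increments[where F = \<F> and q = q and a = \<alpha> and B = B and m = m,
        OF prob_space_axioms \<F> mono qM q1 qa ql B\<F> assms(14) assms(11) le less_imp_le[OF \<theta>(1)] \<theta>(2) lam c]
    show "Bad j \<in> sets M" unfolding Bad_def D_def by (rule V(1))
    have "emeasure M (Bad j) \<le> ennreal (1 / (1 / budget \<delta> j))"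
      unfolding Bad_def D_def by (rule V(2))
    then show "emeasure M (Bad j) \<le> ennreal (budget \<delta> j)" by simp
  qed
  have "emeasure M (\<Union>j. Bad j) \<le> (\<Sum>j. emeasure M (Bad j))"
    using Bad by (intro emeasure_subadditive_countably) auto
  also have "\<dots> \<le> (\<Sum>j. ennreal (budget \<delta> j))" by (intro suminf_le Bad) auto
  also have "\<dots> = ennreal \<delta>"
    using budget_sums[of \<delta>] budget_pos[OF \<delta>(1)] less_imp_le
    by (subst suminf_ennreal2) (auto simp: sums_iff)
  finally have UBad: "measure M (\<Union>j. Bad j) \<le> \<delta>"
    using \<delta> by (simp add: emeasure_eq_measure ennreal_le_iff)
  let ?Good = "{\<omega> \<in> space M. \<forall>k \<in> hyp_index m.
             (\<Sum>i=1..k. (1 - h (\<pi> i \<omega>)) * of_bool (p (\<pi> i \<omega>) \<omega> \<le> \<alpha> i \<omega>))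
               \<le> Vbar h p \<pi> \<alpha> lam \<delta> k \<omega>}"
  have good: "(\<Sum>i=1..k. (1 - h (\<pi> i \<omega>)) * of_bool (p (\<pi> i \<omega>) \<omega> \<le> \<alpha> i \<omega>)) \<le> Vbar h p \<pi> \<alpha> lam \<delta> k \<omega>"
    if w: "\<omega> \<in> space M" "\<omega> \<notin> (\<Union>j. Bad j)" and k: "k \<in> hyp_index m" for \<omega> k
  proof -
    let ?b = "\<lambda>i. indicator (B i) \<omega> :: real"
    have k1: "1 \<le> k" using k by (auto simp: hyp_index_def)
    have \<alpha>0: "0 \<le> \<alpha> i \<omega>" if "i \<in> {1..k}" for i
      using that by (intro assms(11) hyp_index_mono[OF k] w) auto
    define S where "S = (\<Sum>i=2..k. ?b i * D i \<omega>)"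
    define U where "U = (\<Sum>i=1..k. ?b i * nu lam (\<alpha> i \<omega>))"
    have U_eq: "U = ?b 1 * nu lam (\<alpha> 1 \<omega>) + (\<Sum>i=2..k. ?b i * nu lam (\<alpha> i \<omega>))"
      unfolding U_def using k1 by (subst sum.atLeast_Suc_atMost) (auto simp: numeral_2_eq_2)
    have nu0: "0 \<le> ?b i * nu lam (\<alpha> i \<omega>)" if "i \<in> {1..k}" for i
      using \<alpha>0[OF that] lam by (simp add: nu_nonneg)
    have U: "0 \<le> U" unfolding U_def by (intro sum_nonneg nu0)
    have U2: "(\<Sum>i=2..k. ?b i * nu lam (\<alpha> i \<omega>)) \<le> U"
      using nu0[of 1] k1 unfolding U_eq by simp
    have "S \<le> slope \<delta> j / 2 * U + - ln (budget \<delta> j) / slope \<delta> j + - ln (budget \<delta> j) / 2" for j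
    proof -
      define x e where "x = slope \<delta> j" and "e = - ln (budget \<delta> j)"
      have x: "0 < x" using sl by (simp add: x_def)
      have "(\<Sum>i=2..k. ?b i * (\<theta> j * D i \<omega> - (\<theta> j)\<^sup>2 / (2 - \<theta> j) * nu lam (\<alpha> i \<omega>))) < ln (1 / budget \<delta> j)"
        using w k unfolding Bad_def by (force simp: not_le)
      also have "ln (1 / budget \<delta> j) = e" using budget_pos[OF \<delta>(1)] by (simp add: e_def ln_div)
      also have "(\<Sum>i=2..k. ?b i * (\<theta> j * D i \<omega> - (\<theta> j)\<^sup>2 / (2 - \<theta> j) * nu lam (\<alpha> i \<omega>)))
        = \<theta> j * S - (\<theta> j)\<^sup>2 / (2 - \<theta> j) * (\<Sum>i=2..k. ?b i * nu lam (\<alpha> i \<omega>))"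
        unfolding S_def sum_distrib_left sum_subtractf[symmetric] by (intro sum.cong) (auto simp: algebra_simps)
      finally have "\<theta> j * S < (\<theta> j)\<^sup>2 / (2 - \<theta> j) * (\<Sum>i=2..k. ?b i * nu lam (\<alpha> i \<omega>)) + e" by simp
      \<comment> \<open>Adding the nonnegative first term turns the compensator into
        \<open>U\<close>, the argument of \<open>Delta\<close>.\<close>
      also have "\<dots> \<le> (\<theta> j)\<^sup>2 / (2 - \<theta> j) * U + e"
        using U2 \<theta>[of j] by (intro add_right_mono mult_left_mono) auto
      also have "(\<theta> j)\<^sup>2 / (2 - \<theta> j) = \<theta> j * (x / 2)"
      proof -
        have "\<theta> j = x / 2 * (2 - \<theta> j)" using x by (simp add: \<theta>_def x_def[symmetric] field_simps)
        from arg_cong[OF this, of "\<lambda>v. \<theta> j * v"] show ?thesis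
          using \<theta>[of j] by (simp add: nonzero_divide_eq_eq power2_eq_square mult.assoc)
      qed
      also have "\<theta> j * (x / 2) * U + e = \<theta> j * (x / 2 * U + e / x + e / 2)"
      proof -
        have "e / x + e / 2 = e * ((2 + x) / (2 * x))" "\<theta> j = 1 / ((2 + x) / (2 * x))"
          using x by (simp_all add: \<theta>_def x_def[symmetric] field_simps)
        then have "\<theta> j * (e / x + e / 2) = e" using x by simp
        then show ?thesis by (simp add: algebra_simps)
      qed
      finally have "S < x / 2 * U + e / x + e / 2" using \<theta>[of j] by simp
      then show ?thesis unfolding x_def e_def by simp
    qed
    then have "S + 1 \<le> Delta \<delta> U" by (intro Delta_ge_lines[OF \<delta> U])
    \<comment> \<open>The first increment is at most 1 for every outcome, being an indicator minus a
      nonnegative term, times 0 or 1.\<close>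
    moreover have "(\<Sum>i=1..k. ?b i * D i \<omega>) \<le> 1 + S"
    proof -
      have "0 \<le> \<alpha> 1 \<omega> / (1 - lam)" using \<alpha>0[of 1] k1 lam by simp
      then have "?b 1 * D 1 \<omega> \<le> 1" by (simp add: D_def indicator_def)
      moreover have "(\<Sum>i=1..k. ?b i * D i \<omega>) = ?b 1 * D 1 \<omega> + S"
        unfolding S_def using k1 by (subst sum.atLeast_Suc_atMost) (auto simp: numeral_2_eq_2)
      ultimately show ?thesis by simp
    qed
    ultimately have "(\<Sum>i=1..k. ?b i * D i \<omega>) \<le> Delta \<delta> U" by simp
    then show ?thesis
      unfolding Vbar_def hB[OF w(1)] U_def D_def q_def
      by (simp add: right_diff_distrib sum_subtractf mult.assoc)
  qed
  \<comment> \<open>Monotonicity of the measure needs this, since a nonmeasurable set would be given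
    measure 0.\<close>
  have "?Good \<in> sets M"
  proof -
    have "?Good = {\<omega> \<in> space M. \<forall>k \<in> hyp_index m.
        (\<Sum>i=1..k. indicator (B i) \<omega> * of_bool (q i \<omega> \<le> \<alpha> i \<omega>))
          \<le> (\<Sum>i=1..k. indicator (B i) \<omega> * of_bool (q i \<omega> > lam) * (\<alpha> i \<omega> / (1 - lam)))
            + Delta \<delta> (\<Sum>i=1..k. indicator (B i) \<omega> * nu lam (\<alpha> i \<omega>))}"
      using hB by (auto simp: Vbar_def q_def)
    also have "\<dots> \<in> sets M"
    proof (unfold Ball_def, rule sets.sets_Collect_countable_All)
      fix k
      have "{\<omega> \<in> space M. (\<Sum>i=1..k. indicator (B i) \<omega> * of_bool (q i \<omega> \<le> \<alpha> i \<omega>))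
          \<le> (\<Sum>i=1..k. indicator (B i) \<omega> * of_bool (q i \<omega> > lam) * (\<alpha> i \<omega> / (1 - lam)))
            + Delta \<delta> (\<Sum>i=1..k. indicator (B i) \<omega> * nu lam (\<alpha> i \<omega>))} \<in> sets M"
        if k: "k \<in> hyp_index m"
      proof -
        have m: "B i \<in> sets M" "q i \<in> borel_measurable M" "\<alpha> i \<in> borel_measurable M" if "i \<in> {1..k}" for i
        proof -
          have i: "i \<in> hyp_index m" using that by (auto intro: hyp_index_mono[OF k])
          show "B i \<in> sets M" "q i \<in> borel_measurable M" "\<alpha> i \<in> borel_measurable M"
            using B\<F>[OF i] \<F>[OF i] qM[OF i] \<alpha>M[OF i] by (auto simp: subalgebra_def)
        qed
        have [measurable]: "Delta \<delta> \<in> borel_measurable borel" "nu lam \<in> borel_measurable borel"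
          unfolding Delta_def eps_def nu_def by measurable
        have "(\<lambda>\<omega>. \<Sum>i=1..k. indicator (B i) \<omega> * of_bool (q i \<omega> \<le> \<alpha> i \<omega>) :: real) \<in> borel_measurable M"
          by (rule borel_measurable_sum) (use m in measurable)
        moreover have "(\<lambda>\<omega>. \<Sum>i=1..k. indicator (B i) \<omega> * of_bool (q i \<omega> > lam) * (\<alpha> i \<omega> / (1 - lam)))
            \<in> borel_measurable M"
          by (rule borel_measurable_sum) (use m in measurable)
        moreover have "(\<lambda>\<omega>. Delta \<delta> (\<Sum>i=1..k. indicator (B i) \<omega> * nu lam (\<alpha> i \<omega>))) \<in> borel_measurable M"
          by (rule measurable_compose[OF borel_measurable_sum]) (use m in measurable)
        ultimately show ?thesis by (intro borel_measurable_le borel_measurable_add)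
      qed
      then show "{\<omega> \<in> space M. k \<in> hyp_index m \<longrightarrow>
          (\<Sum>i=1..k. indicator (B i) \<omega> * of_bool (q i \<omega> \<le> \<alpha> i \<omega>))
          \<le> (\<Sum>i=1..k. indicator (B i) \<omega> * of_bool (q i \<omega> > lam) * (\<alpha> i \<omega> / (1 - lam)))
            + Delta \<delta> (\<Sum>i=1..k. indicator (B i) \<omega> * nu lam (\<alpha> i \<omega>))} \<in> sets M"
        by (cases "k \<in> hyp_index m") simp_all
    qed
    finally show ?thesis .
  qed
  moreover have "space M - (\<Union>j. Bad j) \<subseteq> ?Good" using good by auto
  ultimately have "measure M (space M - (\<Union>j. Bad j)) \<le> measure M ?Good"
    by (intro finite_measure_mono)
  then show ?thesis using UBad Bad(1) by (subst (asm) prob_compl) auto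
qed

end
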